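(* Every locally countable Borel partial order of height two has a Borel embedding into Turing reducibility.
   Context: A Borel partial order is a partial order $(P,\leq_P)$ with $P$ a Borel subset of $2^\omega$ and $\leq_P$ a Borel subset of $2^\omega\times 2^\omega$. It is locally countable if every element has at most countably many strict predecessors, and has height $n$ if its longest chain has length exactly $n$. A Borel embedding of $P$ into Turing reducibility is a Borel measurable function $f\colon P\to 2^\omega$ such that for all $x,y\in P$, $x\leq_P y \iff f(x)\leq_T f(y)$. *)

theory Defs
  imports "HOL-Analysis.Analysis"
begin

type_synonym cantor = "nat \<Rightarrow> bool"

definition cantor_borel :: "cantor set set" where
  "cantor_borel = sigma_sets UNIV (range (\<lambda>n. {x :: cantor. x n}))"

definition cantor2_borel :: "(cantor \<times> cantor) set set" where
  "cantor2_borel = sigma_sets UNIV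
     (range (\<lambda>n. {p :: cantor \<times> cantor. fst p n}) \<union> range (\<lambda>n. {p :: cantor \<times> cantor. snd p n}))"

definition borel_measurable_on :: "cantor set \<Rightarrow> (cantor \<Rightarrow> cantor) \<Rightarrow> bool" where
  "borel_measurable_on P f \<longleftrightarrow> (\<forall>B \<in> cantor_borel. P \<inter> f -` B \<in> cantor_borel)"

definition is_chain :: "'a set \<Rightarrow> ('a \<times> 'a) set \<Rightarrow> 'a set \<Rightarrow> bool" where
  "is_chain P R C \<longleftrightarrow> C \<subseteq> P \<and> (\<forall>x\<in>C. \<forall>y\<in>C. (x, y) \<in> R \<or> (y, x) \<in> R)"

definition has_height :: "'a set \<Rightarrow> ('a \<times> 'a) set \<Rightarrow> nat \<Rightarrow> bool" where
  "has_height P R n \<longleftrightarrow>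
     (\<forall>C. is_chain P R C \<longrightarrow> finite C \<and> card C \<le> n) \<and> (\<exists>C. is_chain P R C \<and> finite C \<and> card C = n)"

definition locally_countable :: "'a set \<Rightarrow> ('a \<times> 'a) set \<Rightarrow> bool" where
  "locally_countable P R \<longleftrightarrow> (\<forall>y\<in>P. countable {x\<in>P. (x, y) \<in> R \<and> x \<noteq> y})"

datatype rf = Zero | Succ | Proj nat | Oracle | Comp rf "rf list" | PrimRec rf rf | Mu rf

inductive eval :: "cantor \<Rightarrow> rf \<Rightarrow> nat list \<Rightarrow> nat \<Rightarrow> bool" for A where
  eval_Zero: "eval A Zero xs 0"
| eval_Succ: "eval A Succ (x # xs) (Suc x)"
| eval_Proj: "i < length xs \<Longrightarrow> eval A (Proj i) xs (xs ! i)"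
| eval_Oracle: "eval A Oracle (x # xs) (if A x then 1 else 0)"
| eval_Comp: "list_all2 (\<lambda>g y. eval A g xs y) gs ys \<Longrightarrow> eval A f ys z \<Longrightarrow> eval A (Comp f gs) xs z"
| eval_PrimRec0: "eval A f xs z \<Longrightarrow> eval A (PrimRec f g) (0 # xs) z"
| eval_PrimRecS: "eval A (PrimRec f g) (n # xs) r \<Longrightarrow> eval A g (n # r # xs) z \<Longrightarrow>
                   eval A (PrimRec f g) (Suc n # xs) z"
| eval_Mu: "eval A f (n # xs) 0 \<Longrightarrow> (\<forall>m<n. \<exists>v. v \<noteq> 0 \<and> eval A f (m # xs) v) \<Longrightarrow>
            eval A (Mu f) xs n"
monos list.rel_mono_strong

definition turing_le :: "cantor \<Rightarrow> cantor \<Rightarrow> bool" where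
  "turing_le x y \<longleftrightarrow> (\<exists>e. \<forall>n. eval y e [n] (if x n then 1 else 0))"

end

theory Submission
  imports Defs "HOL-Library.Nat_Bijection" "HOL-Library.Sublist"
begin

text \<open>
  By Lusin--Novikov uniformization there are Borel maps \<open>pre n\<close> such that \<open>pre 0 y, pre 1 y, \<dots>\<close>
  enumerates the predecessors of \<open>y\<close>. A Borel injection \<open>g\<close> of Cantor space into a perfect set is built
  together with a Borel operator \<open>bound\<close> such that, for every sequence \<open>z\<close> in the range of \<open>g\<close>, the
  elements of that range computable from \<open>bound z\<close> are exactly the \<open>z i\<close>. The embedding maps a
  minimal \<open>y\<close> to \<open>g y\<close> and every other \<open>y\<close> to \<open>bound (\<lambda>n. g (pre n y))\<close>; since the height is two,
  all strict predecessors are minimal.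

  \<open>bound z\<close> codes \<open>z i\<close> in its \<open>i\<close>-th column up to finitely many bits, which are chosen by finite
  extension. At stage \<open>e\<close> the columns below \<open>k = e\<close> are frozen. If some extension makes the \<open>e\<close>-th
  functional output a string incompatible with all of \<open>z 0, \<dots>, z (k - 1)\<close>, then the perfect set is
  sparse enough for a further extension to push the output off its tree, simultaneously for all
  elements of the perfect set. Only the continuity of Turing functionals is used, not a universal
  machine.
\<close>

section \<open>Oracle computations\<close>

instance rf :: countable by countable_datatype

inductive_cases eval_ZeroE: "eval A Zero xs z"
inductive_cases eval_SuccE: "eval A Succ xs z"
inductive_cases eval_ProjE: "eval A (Proj i) xs z"
inductive_cases eval_OracleE: "eval A Oracle xs z"
inductive_cases eval_CompE: "eval A (Comp f gs) xs z"
inductive_cases eval_PrimRec0E: "eval A (PrimRec f g) (0 # xs) z"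
inductive_cases eval_PrimRecSE: "eval A (PrimRec f g) (Suc n # xs) z"
inductive_cases eval_MuE: "eval A (Mu f) xs z"

lemma eval_determ: "eval A e xs y \<Longrightarrow> eval A e xs z \<Longrightarrow> y = z"
proof (induction arbitrary: z rule: eval.induct)
  case (eval_Comp xs gs ys f w)
  from eval_Comp.prems obtain ys' where ys': "list_all2 (\<lambda>g y. eval A g xs y) gs ys'" "eval A f ys' z"
    by (rule eval_CompE)
  have "ys = ys'"
    using eval_Comp(1) ys'(1)
    by (auto simp: list_all2_conv_all_nth intro!: nth_equalityI)
  then show ?case using eval_Comp ys' by blast
next
  case (eval_Mu f n xs)
  from eval_Mu.prems have z: "eval A f (z # xs) 0" "\<forall>m<z. \<exists>v. v \<noteq> 0 \<and> eval A f (m # xs) v"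
    by (auto elim: eval_MuE)
  \<comment> \<open>If the two values differed, \<open>f\<close> would evaluate at the smaller one
    both to zero and to a nonzero number.\<close>
  have "\<not> z < n" using eval_Mu.IH(2) eval_Mu.hyps z(1) by fastforce
  moreover have "\<not> n < z" using eval_Mu.IH(1) z(2) by (metis)
  ultimately show ?case by simp
next
  case (eval_PrimRecS f g n xs r w)
  from eval_PrimRecS.prems obtain r' where "eval A (PrimRec f g) (n # xs) r'" "eval A g (n # r' # xs) z"
    by (rule eval_PrimRecSE)
  then show ?case using eval_PrimRecS.IH by metis
next
  case (eval_PrimRec0 f xs w g)
  from eval_PrimRec0.prems have "eval A f xs z" by (rule eval_PrimRec0E)
  then show ?case by (rule eval_PrimRec0.IH)
qed (erule eval_ZeroE eval_SuccE eval_ProjE eval_OracleE, simp)+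

text \<open>Each argument of a composition has its own use; the maximum over the finite list serves
  all of them.\<close>

lemma list_all2_common_bound:
  assumes "list_all2 (\<lambda>g y. \<exists>u::nat. \<forall>B. (\<forall>m<u. A m = B m) \<longrightarrow> Q B g y) gs ys"
  shows "\<exists>u::nat. \<forall>B. (\<forall>m<u. A m = B m) \<longrightarrow> list_all2 (Q B) gs ys"
  using assms
proof (induction rule: list_all2_induct)
  case (Cons g gs y ys)
  then obtain u v where "\<forall>B. (\<forall>m<u. A m = B m) \<longrightarrow> Q B g y" 
    "\<forall>B. (\<forall>m<v. A m = B m) \<longrightarrow> list_all2 (Q B) gs ys" by blast
  then show ?case by (intro exI[of _ "max u v"]) auto
qed simp

text \<open>A terminating derivation is finite, so it queries only finitely many oracle bits, and
  \<open>u\<close> bounds all of them. This is the continuity of Turing functionals.\<close>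

lemma eval_use:
  "eval A e xs z \<Longrightarrow> \<exists>u. \<forall>B. (\<forall>m<u. A m = B m) \<longrightarrow> eval B e xs z"
proof (induction rule: eval.induct)
  case (eval_Oracle x xs)
  show ?case
  proof (intro exI[of _ "Suc x"] allI impI)
    fix B assume "\<forall>m<Suc x. A m = B m"
    then show "eval B Oracle (x # xs) (if A x then 1 else 0)"
      using eval.eval_Oracle[of B x xs] by simp
  qed
next
  case (eval_Comp xs gs ys f z)
  have "\<exists>u. \<forall>B. (\<forall>m<u. A m = B m) \<longrightarrow> list_all2 (\<lambda>g y. eval B g xs y) gs ys"
    by (rule list_all2_common_bound, rule list_all2_mono[OF eval_Comp(1)]) (rule conjunct2)
  then obtain u v where "\<forall>B. (\<forall>m<u. A m = B m) \<longrightarrow> list_all2 (\<lambda>g y. eval B g xs y) gs ys"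
    "\<forall>B. (\<forall>m<v. A m = B m) \<longrightarrow> eval B f ys z" using eval_Comp.IH by blast
  then show ?case by (intro exI[of _ "max u v"] allI impI, intro eval.eval_Comp[of _ _ gs ys]) auto
next
  case (eval_PrimRecS f g n xs r z)
  then obtain u v where "\<forall>B. (\<forall>m<u. A m = B m) \<longrightarrow> eval B (PrimRec f g) (n # xs) r"
    "\<forall>B. (\<forall>m<v. A m = B m) \<longrightarrow> eval B g (n # r # xs) z" by blast
  then show ?case by (intro exI[of _ "max u v"] allI impI, intro eval.eval_PrimRecS[of _ f g n xs r]) auto
next
  case (eval_Mu f n xs)
  \<comment> \<open>The search makes \<open>n\<close> unsuccessful tests before it stops; their uses
    are combined by induction on the number \<open>k\<close> of tests.\<close>
  have "\<forall>k\<le>n. \<exists>u. \<forall>B. (\<forall>m<u. A m = B m) \<longrightarrow> (\<forall>m<k. \<exists>v. v \<noteq> 0 \<and> eval B f (m # xs) v)"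
  proof (intro allI impI)
    fix k assume "k \<le> n"
    then show "\<exists>u. \<forall>B. (\<forall>m<u. A m = B m) \<longrightarrow> (\<forall>m<k. \<exists>v. v \<noteq> 0 \<and> eval B f (m # xs) v)"
    proof (induction k)
      case (Suc k)
      then obtain u where u: "\<forall>B. (\<forall>m<u. A m = B m) \<longrightarrow> (\<forall>m<k. \<exists>v. v \<noteq> 0 \<and> eval B f (m # xs) v)" by auto
      obtain v w where v: "v \<noteq> 0" "\<forall>B. (\<forall>m<w. A m = B m) \<longrightarrow> eval B f (k # xs) v"
        using eval_Mu.IH(2)[rule_format, of k] Suc.prems by auto
      show ?case
      proof (rule exI[of _ "max u w"], intro allI impI)
        fix B m assume B: "\<forall>m<max u w. A m = B m" and m: "m < Suc k"
        have "\<forall>m<k. \<exists>v. v \<noteq> 0 \<and> eval B f (m # xs) v" using u B by simp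
        moreover have "eval B f (k # xs) v" using v(2) B by simp
        ultimately show "\<exists>v. v \<noteq> 0 \<and> eval B f (m # xs) v"
          using v(1) m by (cases "m = k") auto
      qed
    qed simp
  qed
  from this[rule_format, OF order_refl]
  obtain u where u: "\<forall>B. (\<forall>m<u. A m = B m) \<longrightarrow> (\<forall>m<n. \<exists>v. v \<noteq> 0 \<and> eval B f (m # xs) v)"
    by metis
  obtain w where w: "\<forall>B. (\<forall>m<w. A m = B m) \<longrightarrow> eval B f (n # xs) 0" using eval_Mu.IH(1) by blast
  show ?case
    by (intro exI[of _ "max u w"] allI impI, rule eval.eval_Mu) (use u w in auto)
next
  case (eval_PrimRec0 f xs z g)
  then obtain u where "\<forall>B. (\<forall>m<u. A m = B m) \<longrightarrow> eval B f xs z" by blast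
  then show ?case by (intro exI[of _ u] allI impI, intro eval.eval_PrimRec0) simp
qed (simp_all add: eval_Zero eval_Succ eval_Proj)

section \<open>Composition of reductions by oracle substitution\<close>

primrec subst_oracle :: "rf \<Rightarrow> rf \<Rightarrow> rf" where
  "subst_oracle d Zero = Zero"
| "subst_oracle d Succ = Succ"
| "subst_oracle d (Proj i) = Proj i"
| "subst_oracle d Oracle = Comp d [Proj 0]"
| "subst_oracle d (Comp f gs) = Comp (subst_oracle d f) (map (subst_oracle d) gs)"
| "subst_oracle d (PrimRec f g) = PrimRec (subst_oracle d f) (subst_oracle d g)"
| "subst_oracle d (Mu f) = Mu (subst_oracle d f)"

lemma eval_Proj_eq: "i < length xs \<Longrightarrow> xs ! i = z \<Longrightarrow> eval A (Proj i) xs z"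
  using eval_Proj[of i xs A] by simp

lemma eval_Comp1: "eval A g xs y \<Longrightarrow> eval A f [y] z \<Longrightarrow> eval A (Comp f [g]) xs z"
  by (rule eval_Comp[of _ _ _ "[y]"]) auto

lemma eval_Comp2:
  "eval A g xs y \<Longrightarrow> eval A h xs y' \<Longrightarrow> eval A f [y, y'] z \<Longrightarrow> eval A (Comp f [g, h]) xs z"
  by (rule eval_Comp[of _ _ _ "[y, y']"]) auto

text \<open>\<open>Oracle\<close> looks only at the head of its argument list, so calling
  \<open>d\<close> on \<open>Proj 0\<close> answers the same query from the other oracle; everything
  else passes through.\<close>

lemma eval_subst_oracle:
  assumes d: "\<And>n. eval B d [n] (if A n then 1 else 0)"
  shows "eval A e xs z \<Longrightarrow> eval B (subst_oracle d e) xs z"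
proof (induction rule: eval.induct)
  case (eval_Oracle x xs)
  have "eval B (Comp d [Proj 0]) (x # xs) (if A x then 1 else 0)"
    by (rule eval_Comp1[OF _ d]) (auto intro: eval_Proj_eq)
  then show ?case by simp
next
  case (eval_Comp xs gs ys f z)
  then have "list_all2 (\<lambda>g y. eval B g xs y) (map (subst_oracle d) gs) ys"
    unfolding list.rel_map by (elim list_all2_mono) (rule conjunct2)
  then show ?case using eval.eval_Comp eval_Comp.IH(2) by simp
next
  case (eval_PrimRecS f g n xs r z)
  then show ?case by (auto intro: eval.eval_PrimRecS[of _ _ _ _ _ r])
next
  case (eval_Mu f n xs)
  then show ?case by (auto intro!: eval.eval_Mu)
next
  case (eval_PrimRec0 f xs z g)
  then show ?case by (simp add: eval.eval_PrimRec0)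
qed (simp_all add: eval_Zero eval_Succ eval_Proj)

lemma turing_le_trans: "turing_le x y \<Longrightarrow> turing_le y z \<Longrightarrow> turing_le x z"
  unfolding turing_le_def
proof (elim exE)
  fix e d
  assume "\<forall>n. eval y e [n] (if x n then 1 else 0)" "\<forall>n. eval z d [n] (if y n then 1 else 0)"
  then have "eval z (subst_oracle d e) [n] (if x n then 1 else 0)" for n
    using eval_subst_oracle[of z d y e "[n]"] by simp
  then show "\<exists>e. \<forall>n. eval z e [n] (if x n then 1 else 0)" by blast
qed

section \<open>Reading a column of the oracle\<close>

definition computes :: "rf \<Rightarrow> (nat \<Rightarrow> nat) \<Rightarrow> bool" where
  "computes d c \<longleftrightarrow> (\<forall>A n. eval A d [n] (c n))"

text \<open>Finitely many irregular bits can be hard-coded. The induction on \<open>N\<close>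
  removes bit 0 of \<open>x\<close> and applies the hypothesis to the shifted sequence.\<close>

lemma turing_le_eventually_reindexed:
  assumes "computes d c" "\<And>m. N \<le> m \<Longrightarrow> x m = y (c m)"
  shows "turing_le x y"
  using assms
proof (induction N arbitrary: x d c)
  case 0
  show ?case unfolding turing_le_def
  proof (intro exI allI)
    fix n
    show "eval y (Comp Oracle [d]) [n] (if x n then 1 else 0)"
      using 0 eval_Oracle[of y "c n" "[]"]
      by (auto simp: computes_def intro!: eval_Comp1 split: if_splits)
  qed
next
  case (Suc N)
  have "computes (Comp d [Succ]) (\<lambda>n. c (Suc n))"
    unfolding computes_def
    by (intro allI, rule eval_Comp1[OF eval_Succ]) (use Suc.prems(1) in \<open>simp add: computes_def\<close>)
  moreover have "x (Suc m) = y (c (Suc m))" if "N \<le> m" for m using Suc.prems(2) that by simp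
  ultimately have "turing_le (\<lambda>m. x (Suc m)) y" by (rule Suc.IH)
  then obtain e where e: "\<And>n. eval y e [n] (if x (Suc n) then 1 else 0)"
    unfolding turing_le_def by auto
  define b where "b = (if x 0 then Comp Succ [Zero] else Zero)"
  have b: "eval y b [] (if x 0 then 1 else 0)"
    unfolding b_def by (auto intro: eval_Zero intro!: eval_Comp1 eval_Succ[where xs="[]", simplified])
  \<comment> \<open>The recursion discards its recursive value: the base case supplies bit 0, and
    the step from \<open>n\<close> calls \<open>e\<close> on \<open>n\<close> to obtain bit
    \<open>Suc n\<close>.\<close>
  have "eval y (PrimRec b (Comp e [Proj 0])) [n] (if x n then 1 else 0)" for n
  proof (induction n)
    case 0
    show ?case by (rule eval_PrimRec0[OF b])
  next
    case (Suc n)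
    show ?case
      by (rule eval_PrimRecS[OF Suc], rule eval_Comp1[OF _ e]) (auto intro: eval_Proj_eq)
  qed
  then show ?case unfolding turing_le_def by blast
qed

definition add_rf :: rf where "add_rf = PrimRec (Proj 0) (Comp Succ [Proj 1])"

lemma eval_add_rf: "eval A add_rf [m, n] (m + n)"
proof (induction m)
  case 0
  show ?case by (auto simp: add_rf_def intro!: eval_PrimRec0 eval_Proj_eq)
next
  case (Suc m)
  show ?case
    unfolding add_rf_def
    by (rule eval_PrimRecS[OF Suc[unfolded add_rf_def]])
      (auto intro!: eval_Comp1[of _ _ _ "m + n"] eval_Proj_eq eval_Succ)
qed

definition triangle_rf :: rf where
  "triangle_rf = PrimRec Zero (Comp add_rf [Proj 1, Comp Succ [Proj 0]])"

lemma eval_triangle_rf: "eval A triangle_rf [n] (triangle n)"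
proof (induction n)
  case 0
  show ?case by (auto simp: triangle_rf_def intro!: eval_PrimRec0 eval_Zero)
next
  case (Suc n)
  have "eval A (Comp add_rf [Proj 1, Comp Succ [Proj 0]]) [n, triangle n] (triangle n + Suc n)"
    by (rule eval_Comp2[OF _ _ eval_add_rf]) (auto intro!: eval_Proj_eq eval_Comp1[of _ _ _ n] eval_Succ)
  then show ?case
    using eval_PrimRecS[OF Suc[unfolded triangle_rf_def]] by (simp add: triangle_rf_def)
qed

lemma computes_add_const: "\<exists>d. computes d (\<lambda>m. i + m)"
proof (induction i)
  case 0
  show ?case by (rule exI[of _ "Proj 0"]) (auto simp: computes_def intro: eval_Proj_eq)
next
  case (Suc i)
  then obtain d where "computes d (\<lambda>m. i + m)" by auto
  then have "computes (Comp Succ [d]) (\<lambda>m. Suc i + m)"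
    unfolding computes_def by (auto intro!: eval_Comp1 eval_Succ)
  then show ?case by blast
qed

lemma computes_comp:
  assumes "computes d c" "computes d' c'"
  shows "computes (Comp d' [d]) (\<lambda>n. c' (c n))"
  unfolding computes_def
proof (intro allI)
  fix A n
  show "eval A (Comp d' [d]) [n] (c' (c n))"
    by (rule eval_Comp1[of _ _ _ "c n"]) (use assms in \<open>simp_all add: computes_def\<close>)
qed

text \<open>\<open>prod_encode (i, m)\<close> is \<open>triangle (i + m) + i\<close>, so for
  constant \<open>i\<close> it is built from a constant shift, triangle numbers, and the same shift
  again.\<close>

lemma computes_prod_encode: "\<exists>d. computes d (\<lambda>m. prod_encode (i, m))"
proof -
  obtain d where d: "computes d (\<lambda>m. i + m)" using computes_add_const by blast
  have "computes triangle_rf triangle" using eval_triangle_rf by (simp add: computes_def)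
  from computes_comp[OF computes_comp[OF d this] d] show ?thesis
    by (auto simp: prod_encode_def add.commute)
qed

lemma turing_le_column:
  assumes "\<And>m. N \<le> m \<Longrightarrow> x m = y (prod_encode (i, m))"
  shows "turing_le x y"
proof -
  obtain d where "computes d (\<lambda>m. prod_encode (i, m))" using computes_prod_encode by blast
  then show ?thesis by (rule turing_le_eventually_reindexed) (fact assms)
qed

lemma turing_le_refl: "turing_le x x"
proof -
  obtain d where "computes d (\<lambda>m. 0 + m)" using computes_add_const by blast
  then show ?thesis by (rule turing_le_eventually_reindexed[of _ _ 0]) simp
qed

text \<open>Computation from a finite oracle string, expressed through all total oracles extending
  it, so that \<open>eval\<close> never meets a partial oracle.\<close>

definition outputs :: "rf \<Rightarrow> bool list \<Rightarrow> bool list \<Rightarrow> bool" where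
  "outputs e \<rho> \<tau> \<longleftrightarrow> (\<forall>A. (\<forall>i<length \<rho>. A i = \<rho> ! i) \<longrightarrow>
      (\<forall>m<length \<tau>. eval A e [m] (if \<tau> ! m then 1 else 0)))"

abbreviation restr :: "(nat \<Rightarrow> 'a) \<Rightarrow> nat \<Rightarrow> 'a list" where
  "restr x n \<equiv> map x [0..<n]"

lemma restr_eq_iff: "restr x n = restr y n \<longleftrightarrow> (\<forall>m<n. x m = y m)"
  by auto

lemma outputs_prefix:
  assumes "outputs e \<rho> \<tau>" "prefix \<rho> \<rho>'"
  shows "outputs e \<rho>' \<tau>"
  unfolding outputs_def
proof (intro allI impI)
  fix A m assume A: "\<forall>i<length \<rho>'. A i = \<rho>' ! i" and m: "m < length \<tau>"
  obtain \<sigma> where "\<rho>' = \<rho> @ \<sigma>" using assms(2) by (rule prefixE)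
  then have "\<forall>i<length \<rho>. A i = \<rho> ! i" using A by (simp add: nth_append)
  then show "eval A e [m] (if \<tau> ! m then 1 else 0)"
    using assms(1) m unfolding outputs_def by simp
qed

lemma outputs_take: "outputs e \<rho> \<tau> \<Longrightarrow> outputs e \<rho> (take n \<tau>)"
  unfolding outputs_def by simp

lemma outputs_unique:
  assumes "outputs e \<rho> \<tau>" "outputs e \<rho> \<tau>'" "length \<tau> = length \<tau>'"
  shows "\<tau> = \<tau>'"
proof (rule nth_equalityI)
  fix m assume "m < length \<tau>"
  \<comment> \<open>One total oracle extending \<rho> suffices to compare the two outputs;
    \<open>\<lambda>i. \<rho> ! i\<close> is one, whatever its values past the end.\<close>
  then have "(if \<tau> ! m then 1 else 0) = (if \<tau>' ! m then 1 else (0::nat))"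
    using assms(1,2)[unfolded outputs_def, rule_format, of "\<lambda>i. \<rho> ! i" m] assms(3)
    by (intro eval_determ[of "\<lambda>i. \<rho> ! i" e "[m]"]) auto
  then show "\<tau> ! m = \<tau>' ! m" by (auto split: if_splits)
qed (fact assms)

text \<open>The uses of the first \<open>n\<close> computations have a common bound, so a reduction
  yields arbitrarily long outputs from initial segments of its oracle.\<close>

lemma outputs_of_reduction:
  assumes "\<And>m. eval A e [m] (if w m then 1 else 0)"
  shows "\<exists>u. outputs e (restr A u) (restr w n)"
proof -
  have "\<exists>u. \<forall>B. (\<forall>m<u. A m = B m) \<longrightarrow> (\<forall>m<n. eval B e [m] (if w m then 1 else 0))"
  proof (induction n)
    case (Suc n)
    then obtain u v where "\<forall>B. (\<forall>m<u. A m = B m) \<longrightarrow> (\<forall>m<n. eval B e [m] (if w m then 1 else 0))"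
      "\<forall>B. (\<forall>m<v. A m = B m) \<longrightarrow> eval B e [n] (if w n then 1 else 0)"
      using eval_use[OF assms[of n]] by blast
    then show ?case by (intro exI[of _ "max u v"]) (auto simp: less_Suc_eq)
  qed simp
  then obtain u where "\<forall>B. (\<forall>m<u. A m = B m) \<longrightarrow> (\<forall>m<n. eval B e [m] (if w m then 1 else 0))" ..
  then have "outputs e (restr A u) (restr w n)" unfolding outputs_def by simp
  then show ?thesis ..
qed

section \<open>Analytic sets and separation\<close>

definition cantor_algebra :: "cantor measure" where
  "cantor_algebra = sigma UNIV (range (\<lambda>n. {x. x n}))"

definition cantor2_algebra :: "(cantor \<times> cantor) measure" where
  "cantor2_algebra = sigma UNIV (range (\<lambda>n. {p. fst p n}) \<union> range (\<lambda>n. {p. snd p n}))"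

lemma space_cantor_algebra [simp]: "space cantor_algebra = UNIV"
  and sets_cantor_algebra: "sets cantor_algebra = cantor_borel"
  by (auto simp: cantor_algebra_def cantor_borel_def)

lemma space_cantor2_algebra [simp]: "space cantor2_algebra = UNIV"
  and sets_cantor2_algebra: "sets cantor2_algebra = cantor2_borel"
  by (auto simp: cantor2_algebra_def cantor2_borel_def)

lemma pred_cantor_bit [measurable]: "Measurable.pred cantor_algebra (\<lambda>x. x n)"
  by (simp add: pred_def) (auto simp: sets_cantor_algebra cantor_borel_def)

lemma pred_cantor2_fst_bit [measurable]: "Measurable.pred cantor2_algebra (\<lambda>p. fst p n)"
  by (simp add: pred_def) (auto simp: sets_cantor2_algebra cantor2_borel_def)

lemma pred_cantor2_snd_bit [measurable]: "Measurable.pred cantor2_algebra (\<lambda>p. snd p n)"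
  by (simp add: pred_def) (auto simp: sets_cantor2_algebra cantor2_borel_def)

lemma measurable_into_cantor:
  assumes "\<And>n. Measurable.pred M (\<lambda>x. h x n)"
  shows "h \<in> M \<rightarrow>\<^sub>M cantor_algebra"
  unfolding cantor_algebra_def
  by (rule measurable_measure_of) (use assms in \<open>auto simp: pred_def vimage_def Int_def conj_commute\<close>)

lemma measurable_into_cantor2:
  assumes "\<And>n. Measurable.pred M (\<lambda>x. f x n)" "\<And>n. Measurable.pred M (\<lambda>x. g x n)"
  shows "(\<lambda>x. (f x, g x)) \<in> M \<rightarrow>\<^sub>M cantor2_algebra"
  unfolding cantor2_algebra_def
  by (rule measurable_measure_of) (use assms in \<open>auto simp: pred_def vimage_def Int_def conj_commute\<close>)

lemma pred_bit_compose [measurable (raw)]: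
  "h \<in> M \<rightarrow>\<^sub>M cantor_algebra \<Longrightarrow> Measurable.pred M (\<lambda>x. h x n)"
  by (rule measurable_compose[OF _ pred_cantor_bit])

lemma snd_measurable_cantor2: "snd \<in> cantor2_algebra \<rightarrow>\<^sub>M cantor_algebra"
  by (rule measurable_into_cantor) simp

section \<open>Closure properties of analytic sets\<close>

lemma closed_discrete_space: "closed (A :: 'a::discrete_topology set)"
  by (simp add: closed_def open_discrete)

lemma continuous_snd_apply:
  "continuous_on UNIV (\<lambda>p :: 'a::topological_space \<times> ('i \<Rightarrow> 'b::topological_space). snd p k)"
  by (rule continuous_on_product_then_coordinatewise, rule continuous_on_snd, rule continuous_on_id)

lemma continuous_fst_apply:
  "continuous_on UNIV (\<lambda>p :: ('i \<Rightarrow> 'b::topological_space) \<times> 'a::topological_space. fst p k)"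
  by (rule continuous_on_product_then_coordinatewise, rule continuous_on_fst, rule continuous_on_id)

lemma continuous_reindex_snd:
  "continuous_on UNIV (\<lambda>p :: 'a::topological_space \<times> ('i \<Rightarrow> 'b::topological_space). (fst p, \<lambda>k. snd p (c k)))"
  by (intro continuous_on_Pair continuous_on_fst continuous_on_id continuous_on_coordinatewise_then_product
      continuous_snd_apply)

text \<open>Having a closed set upstairs lets a point and its witness be built together as limits of
  finite approximations.\<close>

definition analytic :: "'a::topological_space set \<Rightarrow> bool" where
  "analytic A \<longleftrightarrow> (\<exists>F :: ('a \<times> (nat \<Rightarrow> nat)) set. closed F \<and> A = {a. \<exists>w. (a, w) \<in> F})"

lemma analyticI: "closed (F :: ('a::topological_space \<times> (nat \<Rightarrow> nat)) set) \<Longrightarrow> analytic {a. \<exists>w. (a, w) \<in> F}"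
  unfolding analytic_def by blast

lemma analytic_closed: "closed A \<Longrightarrow> analytic A"
  using analyticI[of "A \<times> UNIV"] by (simp add: closed_Times)

text \<open>A witness for the union begins with an index \<open>i\<close> and continues with a
  witness for \<open>A i\<close>.\<close>

lemma analytic_UN:
  fixes A :: "nat \<Rightarrow> 'a::topological_space set"
  assumes "\<And>i. analytic (A i)"
  shows "analytic (\<Union>i. A i)"
proof -
  obtain F :: "nat \<Rightarrow> ('a \<times> (nat \<Rightarrow> nat)) set"
    where F: "\<And>i. closed (F i)" "\<And>i. A i = {a. \<exists>w. (a, w) \<in> F i}"
    using assms unfolding analytic_def by metis
  define G where "G = (\<Inter>i. {p. snd p 0 \<noteq> i} \<union> (\<lambda>p. (fst p, \<lambda>k. snd p (Suc k))) -` F i)"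
  have "closed {p :: 'a \<times> (nat \<Rightarrow> nat). snd p 0 \<noteq> i}" for i
  proof -
    have "closed ((\<lambda>p :: 'a \<times> (nat \<Rightarrow> nat). snd p 0) -` (- {i}))"
      by (intro closed_vimage closed_discrete_space continuous_snd_apply)
    then show ?thesis by (simp add: vimage_def)
  qed
  moreover have "closed ((\<lambda>p :: 'a \<times> (nat \<Rightarrow> nat). (fst p, \<lambda>k. snd p (Suc k))) -` F i)" for i
    by (intro closed_vimage F continuous_reindex_snd)
  ultimately have "closed G" unfolding G_def by auto
  moreover have "(\<Union>i. A i) = {a. \<exists>w. (a, w) \<in> G}"
  proof (intro equalityI subsetI)
    fix a assume "a \<in> (\<Union>i. A i)"
    then obtain i w where "(a, w) \<in> F i" using F(2) by auto
    then have "(a, case_nat i w) \<in> G" by (auto simp: G_def)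
    then show "a \<in> {a. \<exists>w. (a, w) \<in> G}" by blast
  next
    fix a assume "a \<in> {a. \<exists>w. (a, w) \<in> G}"
    then obtain w where "(a, w) \<in> G" by auto
    then have "(a, \<lambda>k. w (Suc k)) \<in> F (w 0)" by (auto simp: G_def)
    then show "a \<in> (\<Union>i. A i)" using F(2) by auto
  qed
  ultimately show ?thesis unfolding analytic_def by blast
qed

text \<open>A witness for the intersection carries a witness for \<open>A i\<close> in its
  \<open>i\<close>-th column.\<close>

lemma analytic_INT:
  fixes A :: "nat \<Rightarrow> 'a::topological_space set"
  assumes "\<And>i. analytic (A i)"
  shows "analytic (\<Inter>i. A i)"
proof -
  obtain F :: "nat \<Rightarrow> ('a \<times> (nat \<Rightarrow> nat)) set"
    where F: "\<And>i. closed (F i)" "\<And>i. A i = {a. \<exists>w. (a, w) \<in> F i}"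
    using assms unfolding analytic_def by metis
  define G where "G = (\<Inter>i. (\<lambda>p. (fst p, \<lambda>k. snd p (prod_encode (i, k)))) -` F i)"
  have "closed ((\<lambda>p :: 'a \<times> (nat \<Rightarrow> nat). (fst p, \<lambda>k. snd p (prod_encode (i, k)))) -` F i)" for i
    by (intro closed_vimage F continuous_reindex_snd)
  then have "closed G" unfolding G_def by auto
  moreover have "(\<Inter>i. A i) = {a. \<exists>w. (a, w) \<in> G}"
  proof (intro equalityI subsetI)
    fix a assume "a \<in> (\<Inter>i. A i)"
    then have "\<forall>i. \<exists>w. (a, w) \<in> F i" using F(2) by auto
    then obtain w where "\<And>i. (a, w i) \<in> F i" by metis
    then have "(a, \<lambda>n. w (fst (prod_decode n)) (snd (prod_decode n))) \<in> G" by (auto simp: G_def)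
    then show "a \<in> {a. \<exists>w. (a, w) \<in> G}" by blast
  next
    fix a assume "a \<in> {a. \<exists>w. (a, w) \<in> G}"
    then show "a \<in> (\<Inter>i. A i)" using F(2) by (auto simp: G_def)
  qed
  ultimately show ?thesis unfolding analytic_def by blast
qed

lemma analytic_Int:
  assumes "analytic A" "analytic B"
  shows "analytic (A \<inter> B)"
proof -
  have "A \<inter> B = (\<Inter>i::nat. if i = 0 then A else B)" by (auto split: if_splits)
  then show ?thesis using analytic_INT[of "\<lambda>i. if i = 0 then A else B"] assms by simp
qed

lemma analytic_finite_INT:
  assumes "finite I" "\<And>i. i \<in> I \<Longrightarrow> analytic (A i)"
  shows "analytic (\<Inter>i\<in>I. A i)"
  using assms by (induction rule: finite_induct) (auto intro: analytic_Int analytic_closed)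

text \<open>The projected point of Cantor space is absorbed into the witness: even entries code its
  bits, with 0 for true, and odd entries carry the old witness.\<close>

lemma analytic_snd_image:
  fixes E :: "(cantor \<times> 'a::topological_space) set"
  assumes "analytic E"
  shows "analytic (snd ` E)"
proof -
  obtain F :: "((cantor \<times> 'a) \<times> (nat \<Rightarrow> nat)) set" where F: "closed F" "E = {a. \<exists>w. (a, w) \<in> F}"
    using assms unfolding analytic_def by blast
  define G :: "('a \<times> (nat \<Rightarrow> nat)) set"
    where "G = (\<lambda>p. ((\<lambda>k. snd p (2 * k) = 0, fst p), \<lambda>k. snd p (Suc (2 * k)))) -` F"
  have bit: "continuous_on UNIV (\<lambda>p :: 'a \<times> (nat \<Rightarrow> nat). snd p (2 * k) = 0)" for k
    by (rule continuous_on_compose2[OF Topological_Spaces.continuous_on_discrete[of UNIV] continuous_snd_apply]) simp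
  have "closed G" unfolding G_def
    by (intro closed_vimage F(1) continuous_on_Pair continuous_on_coordinatewise_then_product bit
        continuous_on_fst continuous_on_id continuous_snd_apply)
  moreover have "snd ` E = {a. \<exists>w. (a, w) \<in> G}"
  proof (intro equalityI subsetI)
    fix a assume "a \<in> snd ` E"
    then obtain x w where xw: "((x, a), w) \<in> F" using F(2) by auto
    define v where "v n = (if even n then (if x (n div 2) then 0 else 1) else w (n div 2))" for n
    have "(\<lambda>k. v (2 * k) = 0) = x" "(\<lambda>k. v (Suc (2 * k))) = w" by (auto simp: v_def)
    then have "(a, v) \<in> G" using xw by (simp add: G_def)
    then show "a \<in> {a. \<exists>w. (a, w) \<in> G}" by blast
  next
    fix a assume "a \<in> {a. \<exists>w. (a, w) \<in> G}"
    then show "a \<in> snd ` E" unfolding F(2) G_def by force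
  qed
  ultimately show ?thesis unfolding analytic_def by blast
qed

lemma closed_fst_bit: "closed {p :: cantor \<times> cantor. fst p n}" "closed {p :: cantor \<times> cantor. \<not> fst p n}"
proof -
  have "closed ((\<lambda>p :: cantor \<times> cantor. fst p n) -` B)" for B
    by (intro closed_vimage closed_discrete_space continuous_fst_apply continuous_snd_apply)
  from this[of "{True}"] this[of "{False}"]
  show "closed {p :: cantor \<times> cantor. fst p n}" "closed {p :: cantor \<times> cantor. \<not> fst p n}"
    by (simp_all add: vimage_def)
qed

lemma closed_snd_bit: "closed {p :: cantor \<times> cantor. snd p n}" "closed {p :: cantor \<times> cantor. \<not> snd p n}"
proof -
  have "closed ((\<lambda>p :: cantor \<times> cantor. snd p n) -` B)" for B
    by (intro closed_vimage closed_discrete_space continuous_fst_apply continuous_snd_apply)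
  from this[of "{True}"] this[of "{False}"]
  show "closed {p :: cantor \<times> cantor. snd p n}" "closed {p :: cantor \<times> cantor. \<not> snd p n}"
    by (simp_all add: vimage_def)
qed

text \<open>The generators are clopen. Proving the claim for a set and its complement together makes
  the complement step of the induction trivial.\<close>

lemma borel_imp_analytic:
  assumes "B \<in> sets cantor2_algebra"
  shows "analytic B"
proof -
  have "analytic B \<and> analytic (- B)"
    using assms unfolding sets_cantor2_algebra cantor2_borel_def
  proof (induction rule: sigma_sets.induct)
    case (Basic a)
    then show ?case using closed_fst_bit closed_snd_bit by (auto simp: Collect_neg_eq[symmetric] intro!: analytic_closed)
  next
    case Empty
    then show ?case by (simp add: analytic_closed)
  next
    case (Compl a)
    then show ?case by (simp add: Compl_eq_Diff_UNIV[symmetric])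
  next
    case (Union a)
    then show ?case by (simp add: analytic_UN analytic_INT)
  qed
  then show ?thesis by simp
qed

section \<open>Limits in closed sets and Lusin separation\<close>

lemma tendsto_fun_if_eventually_eq:
  fixes f :: "nat \<Rightarrow> nat \<Rightarrow> 'a::topological_space"
  assumes "\<And>n m. m < n \<Longrightarrow> f n m = l m"
  shows "f \<longlonglongrightarrow> l"
proof -
  have "limitin (product_topology (\<lambda>_. euclidean) UNIV) f l sequentially"
    unfolding limitin_componentwise
  proof (intro conjI ballI)
    fix k :: nat
    have "\<forall>\<^sub>F n in sequentially. f n k = l k"
      using eventually_gt_at_top[of k] by eventually_elim (use assms in auto)
    then show "limitin euclidean (\<lambda>n. f n k) (l k) sequentially"
      by (simp add: tendsto_eventually)
  qed auto
  then show ?thesis by (simp add: euclidean_product_topology)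
qed

lemma closed_pair_limit:
  fixes F :: "((nat \<Rightarrow> 'a::topological_space) \<times> (nat \<Rightarrow> 'b::topological_space)) set"
  assumes "closed F" "\<And>n. \<exists>x' w'. (x', w') \<in> F \<and> (\<forall>m<n. x' m = x m \<and> w' m = w m)"
  shows "(x, w) \<in> F"
proof -
  obtain X W where XW: "\<And>n. (X n, W n) \<in> F" "\<And>n m. m < n \<Longrightarrow> X n m = x m \<and> W n m = w m"
    using assms(2) by metis
  have "(\<lambda>n. (X n, W n)) \<longlonglongrightarrow> (x, w)"
    by (intro tendsto_Pair tendsto_fun_if_eventually_eq) (use XW(2) in auto)
  then show ?thesis
    by (rule Lim_in_closed_set[OF assms(1) _ _ , rotated -1]) (use XW(1) in auto)
qed

lemma closed_triple_limit:
  fixes F :: "(((nat \<Rightarrow> 'a::topological_space) \<times> (nat \<Rightarrow> 'b::topological_space)) \<times> (nat \<Rightarrow> 'c::topological_space)) set"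
  assumes "closed F" "\<And>n. \<exists>x' y' w'. ((x', y'), w') \<in> F \<and> (\<forall>m<n. x' m = x m \<and> y' m = y m \<and> w' m = w m)"
  shows "((x, y), w) \<in> F"
proof -
  obtain X Y W where XW: "\<And>n. ((X n, Y n), W n) \<in> F" 
    "\<And>n m. m < n \<Longrightarrow> X n m = x m \<and> Y n m = y m \<and> W n m = w m"
    using assms(2) by metis
  have "(\<lambda>n. ((X n, Y n), W n)) \<longlonglongrightarrow> ((x, y), w)"
    by (intro tendsto_Pair tendsto_fun_if_eventually_eq) (use XW(2) in auto)
  then show ?thesis
    by (rule Lim_in_closed_set[OF assms(1) _ _ , rotated -1]) (use XW(1) in auto)
qed

lemma extend_forever:
  assumes "P []" "\<And>l. P l \<Longrightarrow> \<exists>c. P (l @ [c])"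
  shows "\<exists>q :: nat \<Rightarrow> 'c. \<forall>n. P (restr q n)"
proof -
  obtain ch where ch: "\<And>l. P l \<Longrightarrow> P (l @ [ch l])" using assms(2) by metis
  define L where "L = rec_nat [] (\<lambda>_ l. l @ [ch l])"
  have L: "L 0 = []" "\<And>n. L (Suc n) = L n @ [ch (L n)]" by (simp_all add: L_def)
  have "L n = restr (\<lambda>m. ch (L m)) n" for n by (induction n) (simp_all add: L)
  moreover have "P (L n)" for n by (induction n) (use L ch assms(1) in auto)
  ultimately show ?thesis by metis
qed

definition separable :: "cantor set \<Rightarrow> cantor set \<Rightarrow> bool" where
  "separable A B \<longleftrightarrow> (\<exists>D \<in> sets cantor_algebra. A \<subseteq> D \<and> B \<inter> D = {})"

lemma separable_UN:
  fixes A :: "'i::countable \<Rightarrow> cantor set" and B :: "'j::countable \<Rightarrow> cantor set"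
  assumes "\<And>i j. separable (A i) (B j)"
  shows "separable (\<Union>i. A i) (\<Union>j. B j)"
proof -
  obtain D where D: "\<And>i j. D i j \<in> sets cantor_algebra" "\<And>i j. A i \<subseteq> D i j" "\<And>i j. B j \<inter> D i j = {}"
    using assms unfolding separable_def by metis
  have "(\<Union>i. \<Inter>j. D i j) \<in> sets cantor_algebra"
    using sets.top[of cantor_algebra] by (intro sets.countable_UN'' sets.countable_INT'') (use D in auto)
  moreover have "(\<Union>i. A i) \<subseteq> (\<Union>i. \<Inter>j. D i j)" using D(2) by blast
  moreover have "(\<Union>j. B j) \<inter> (\<Union>i. \<Inter>j. D i j) = {}" using D(3) by blast
  ultimately show ?thesis unfolding separable_def by blast
qed

text \<open>Inseparability passes to some pair of smaller cells, because both sides split into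
  countably many. A letter of \<open>l\<close> prescribes one bit of the point, which both cells
  share, and one entry of each witness. In the limit, closedness gives a common point of
  \<open>A\<close> and \<open>B\<close>.\<close>

theorem lusin_separation:
  assumes "analytic A" "analytic B" "A \<inter> B = {}"
  shows "separable A B"
proof (rule ccontr)
  assume nsep: "\<not> separable A B"
  obtain F G :: "(cantor \<times> (nat \<Rightarrow> nat)) set"
    where F: "closed F" "A = {a. \<exists>w. (a, w) \<in> F}" and G: "closed G" "B = {a. \<exists>w. (a, w) \<in> G}"
    using assms unfolding analytic_def by blast
  define A' where "A' l = {t. \<exists>w. (t, w) \<in> F \<and> (\<forall>m<length l. t m = fst (l ! m) \<and> w m = fst (snd (l ! m)))}"
    for l :: "(bool \<times> nat \<times> nat) list"
  define B' where "B' l = {t. \<exists>w. (t, w) \<in> G \<and> (\<forall>m<length l. t m = fst (l ! m) \<and> w m = snd (snd (l ! m)))}"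
    for l :: "(bool \<times> nat \<times> nat) list"
  have "\<not> separable (A' []) (B' [])" using nsep F(2) G(2) by (simp add: A'_def B'_def)
  moreover have "\<exists>c. \<not> separable (A' (l @ [c])) (B' (l @ [c]))" if l: "\<not> separable (A' l) (B' l)" for l
  proof (rule ccontr)
    assume "\<not> ?thesis"
    then have sep: "separable (A' (l @ [c])) (B' (l @ [c]))" for c by blast
    have A_snoc: "A' (l @ [c]) = {t. \<exists>w. (t, w) \<in> F \<and>
        (\<forall>m<length l. t m = fst (l ! m) \<and> w m = fst (snd (l ! m))) \<and> t (length l) = fst c \<and> w (length l) = fst (snd c)}" for c
      by (simp add: A'_def All_less_Suc nth_append conj_ac)
    have B_snoc: "B' (l @ [c]) = {t. \<exists>w. (t, w) \<in> G \<and>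
        (\<forall>m<length l. t m = fst (l ! m) \<and> w m = snd (snd (l ! m))) \<and> t (length l) = fst c \<and> w (length l) = snd (snd c)}" for c
      by (simp add: B'_def All_less_Suc nth_append conj_ac)
    \<comment> \<open>Each side ignores the witness entry of the other, hence the dummy 0.\<close>
    have A: "A' l = (\<Union>p :: bool \<times> nat. A' (l @ [(fst p, snd p, 0)]))"
    proof (intro equalityI subsetI)
      fix x assume "x \<in> A' l"
      then obtain w where "x \<in> A' (l @ [(x (length l), w (length l), 0)])" unfolding A_snoc A'_def[of l] by auto
      then show "x \<in> (\<Union>p :: bool \<times> nat. A' (l @ [(fst p, snd p, 0)]))"
        by (intro UN_I[of "(x (length l), w (length l))"]) auto
    qed (unfold A_snoc A'_def[of l], blast)
    have B: "B' l = (\<Union>p :: bool \<times> nat. B' (l @ [(fst p, 0, snd p)]))"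
    proof (intro equalityI subsetI)
      fix x assume "x \<in> B' l"
      then obtain w where "x \<in> B' (l @ [(x (length l), 0, w (length l))])" unfolding B_snoc B'_def[of l] by auto
      then show "x \<in> (\<Union>p :: bool \<times> nat. B' (l @ [(fst p, 0, snd p)]))"
        by (intro UN_I[of "(x (length l), w (length l))"]) auto
    qed (unfold B_snoc B'_def[of l], blast)
    have "separable (A' (l @ [(b, i, 0)])) (B' (l @ [(b', 0, j)]))" for b b' i j
    proof (cases "b = b'")
      case True
      have "A' (l @ [(b, i, 0)]) = A' (l @ [(b, i, j)])" "B' (l @ [(b, 0, j)]) = B' (l @ [(b, i, j)])"
        unfolding A_snoc B_snoc by simp_all
      then show ?thesis using sep True by simp
    next
      case False
      \<comment> \<open>Cells that prescribe different next bits are separated by a clopen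
        set.\<close>
      have "{t. t (length l) = b} \<in> sets cantor_algebra"
        using measurable_sets[of "\<lambda>t. t (length l) = b" cantor_algebra "count_space UNIV" "{True}"]
        by (simp add: vimage_def)
      moreover have "A' (l @ [(b, i, 0)]) \<subseteq> {t. t (length l) = b}"
        unfolding A_snoc by auto
      moreover have "B' (l @ [(b', 0, j)]) \<inter> {t. t (length l) = b} = {}"
        using False unfolding B_snoc by auto
      ultimately show ?thesis unfolding separable_def by blast
    qed
    then have "separable (A' l) (B' l)" unfolding A B by (intro separable_UN)
    then show False using l by simp
  qed
  ultimately obtain q where q: "\<And>n. \<not> separable (A' (restr q n)) (B' (restr q n))"
    using extend_forever[of "\<lambda>l. \<not> separable (A' l) (B' l)"] by blast
  have ne: "A' (restr q n) \<noteq> {}" "B' (restr q n) \<noteq> {}" for n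
  proof -
    show "A' (restr q n) \<noteq> {}" using q[of n] unfolding separable_def by (metis Int_empty_right empty_subsetI sets.empty_sets)
    show "B' (restr q n) \<noteq> {}" using q[of n] unfolding separable_def
      by (metis inf_bot_left sets.top space_cantor_algebra subset_UNIV)
  qed
  have "((\<lambda>m. fst (q m)), (\<lambda>m. fst (snd (q m)))) \<in> F"
  proof (rule closed_pair_limit[OF F(1)])
    fix n show "\<exists>x' w'. (x', w') \<in> F \<and> (\<forall>m<n. x' m = fst (q m) \<and> w' m = fst (snd (q m)))"
      using ne(1)[of n] by (auto simp: A'_def)
  qed
  moreover have "((\<lambda>m. fst (q m)), (\<lambda>m. snd (snd (q m)))) \<in> G"
  proof (rule closed_pair_limit[OF G(1)])
    fix n show "\<exists>x' w'. (x', w') \<in> G \<and> (\<forall>m<n. x' m = fst (q m) \<and> w' m = snd (snd (q m)))"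
      using ne(2)[of n] by (auto simp: B'_def)
  qed
  ultimately show False using F(2) G(2) assms(3) by blast
qed

text \<open>By uniqueness of \<open>x\<close>, the \<open>y\<close> whose \<open>x\<close> has bit
  \<open>k\<close> true and those whose \<open>x\<close> has it false form disjoint analytic sets; a
  Borel separator \<open>D k\<close> reads off the bit.\<close>

lemma analytic_unique_sections_graph:
  fixes E :: "(cantor \<times> cantor) set"
  assumes "analytic E" "\<And>x x' y. (x, y) \<in> E \<Longrightarrow> (x', y) \<in> E \<Longrightarrow> x = x'"
  shows "\<exists>h \<in> cantor_algebra \<rightarrow>\<^sub>M cantor_algebra. \<forall>x y. (x, y) \<in> E \<longrightarrow> x = h y"
proof -
  have "separable (snd ` (E \<inter> {p. fst p k})) (snd ` (E \<inter> {p. \<not> fst p k}))" for k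
  proof (rule lusin_separation)
    show "snd ` (E \<inter> {p. fst p k}) \<inter> snd ` (E \<inter> {p. \<not> fst p k}) = {}"
      using assms(2) by fastforce
  qed (intro analytic_snd_image analytic_Int assms(1) analytic_closed closed_fst_bit)+
  then obtain D where D: "\<And>k. D k \<in> sets cantor_algebra" "\<And>k. snd ` (E \<inter> {p. fst p k}) \<subseteq> D k"
    "\<And>k. snd ` (E \<inter> {p. \<not> fst p k}) \<inter> D k = {}"
    unfolding separable_def by metis
  have "(\<lambda>y k. y \<in> D k) \<in> cantor_algebra \<rightarrow>\<^sub>M cantor_algebra"
    by (rule measurable_into_cantor) (use D(1) in measurable)
  moreover have "x = (\<lambda>k. y \<in> D k)" if "(x, y) \<in> E" for x y
  proof
    fix k
    show "x k = (y \<in> D k)"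
      using D(2)[of k] D(3)[of k] that by force
  qed
  ultimately show ?thesis by (intro bexI[of _ "\<lambda>y k. y \<in> D k"]) simp_all
qed

section \<open>Lusin--Novikov uniformization\<close>

lemma uncountable_cantor: "uncountable (UNIV :: cantor set)"
proof
  assume "countable (UNIV :: cantor set)"
  then obtain e :: "nat \<Rightarrow> cantor" where e: "range e = UNIV" by (metis UNIV_not_empty range_from_nat_into)
  have "(\<lambda>n. \<not> e n n) \<in> range e" using e by simp
  then obtain k where "(\<lambda>n. \<not> e n n) = e k" by (rule rangeE)
  from fun_cong[OF this, of k] show False by simp
qed

text \<open>
  Strings over \<^typ>\<open>bool \<times> bool \<times> nat\<close> restrict a point \<open>(x, y)\<close> together with its witness \<open>w\<close>
  in the closed set \<open>F\<close>. A finite set \<open>A\<close> of strings is realized when some single \<open>y\<close> has, for each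
  string of \<open>A\<close>, a point above it that avoids all the graphs \<open>x = h n y\<close>.
\<close>

locale closed_representation =
  fixes F :: "((cantor \<times> cantor) \<times> (nat \<Rightarrow> nat)) set"
  assumes closed_F: "closed F"
begin

definition piece :: "(bool \<times> bool \<times> nat) list \<Rightarrow> (cantor \<times> cantor) set" where
  "piece s = {p. \<exists>w. (p, w) \<in> F \<and> (\<forall>m<length s. fst p m = fst (s ! m) \<and> snd p m = fst (snd (s ! m)) \<and> w m = snd (snd (s ! m)))}"

definition off_graphs :: "(nat \<Rightarrow> cantor \<Rightarrow> cantor) \<Rightarrow> (bool \<times> bool \<times> nat) list \<Rightarrow> cantor \<Rightarrow> cantor \<Rightarrow> bool" where
  "off_graphs h s x y \<longleftrightarrow> (x, y) \<in> piece s \<and> (\<forall>n. x \<noteq> h n y)"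

definition realized :: "(nat \<Rightarrow> cantor \<Rightarrow> cantor) \<Rightarrow> (bool \<times> bool \<times> nat) list set \<Rightarrow> bool" where
  "realized h A \<longleftrightarrow> (\<exists>y. \<forall>s\<in>A. \<exists>x. off_graphs h s x y)"

text \<open>Only first components are compared: the branches of the scheme will share
  \<open>y\<close>, and their points \<open>x\<close> must differ.\<close>

definition apart :: "(bool \<times> bool \<times> nat) list \<Rightarrow> (bool \<times> bool \<times> nat) list \<Rightarrow> bool" where
  "apart p q \<longleftrightarrow> (\<exists>k. k < length p \<and> k < length q \<and> fst (p ! k) \<noteq> fst (q ! k))"

lemma analytic_piece: "analytic (piece s)"
proof -
  have fs: "continuous_on UNIV (\<lambda>p :: (cantor \<times> cantor) \<times> (nat \<Rightarrow> nat). fst (fst p) m)" for m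
    by (rule continuous_on_product_then_coordinatewise, intro continuous_on_fst continuous_on_id)
  have sn: "continuous_on UNIV (\<lambda>p :: (cantor \<times> cantor) \<times> (nat \<Rightarrow> nat). snd (fst p) m)" for m
    by (rule continuous_on_product_then_coordinatewise, intro continuous_on_fst continuous_on_snd continuous_on_id)
  have cl: "closed ((\<lambda>p. fst (fst p) m) -` {fst (s ! m)} \<inter> (\<lambda>p. snd (fst p) m) -` {fst (snd (s ! m))} \<inter>
     (\<lambda>p :: (cantor \<times> cantor) \<times> (nat \<Rightarrow> nat). snd p m) -` {snd (snd (s ! m))})" (is "closed (?C m)") for m
    by (intro closed_Int closed_vimage closed_discrete_space fs sn continuous_snd_apply)
  have "piece s = {p. \<exists>w. (p, w) \<in> F \<inter> (\<Inter>m\<in>{..<length s}. ?C m)}"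
    unfolding piece_def INT_iff Int_iff by (simp add: Ball_def[of "{..<_}"])
  moreover have "closed (F \<inter> (\<Inter>m\<in>{..<length s}. ?C m))"
    using closed_F cl by (intro closed_Int closed_INT) auto
  ultimately show ?thesis by (simp only: analyticI)
qed

text \<open>Avoiding countably many Borel graphs is a Borel condition, so it keeps an analytic piece
  analytic.\<close>

lemma analytic_off_graphs:
  assumes h: "\<And>n. h n \<in> cantor_algebra \<rightarrow>\<^sub>M cantor_algebra"
  shows "analytic {p. off_graphs h s (fst p) (snd p)}"
proof -
  have [measurable]: "(\<lambda>p. h n (snd p)) \<in> cantor2_algebra \<rightarrow>\<^sub>M cantor_algebra" for n
    by (rule measurable_compose[OF snd_measurable_cantor2 h])
  have "{p \<in> space cantor2_algebra. \<forall>n. \<exists>k. fst p k \<noteq> h n (snd p) k} \<in> sets cantor2_algebra"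
    by measurable
  then have "analytic {p. \<forall>n. fst p \<noteq> h n (snd p)}"
    using borel_imp_analytic by (simp add: fun_eq_iff)
  moreover have "{p. off_graphs h s (fst p) (snd p)} = piece s \<inter> {p. \<forall>n. fst p \<noteq> h n (snd p)}"
    by (auto simp: off_graphs_def)
  ultimately show ?thesis by (simp only: analytic_Int analytic_piece)
qed

lemma off_graphs_extend:
  assumes "off_graphs h s x y"
  shows "\<exists>s'. prefix s s' \<and> length s' = length s + N \<and> off_graphs h s' x y \<and> (\<forall>m<length s'. fst (s' ! m) = x m)"
proof -
  obtain w where w: "((x, y), w) \<in> F" "\<forall>m<length s. x m = fst (s ! m) \<and> y m = fst (snd (s ! m)) \<and> w m = snd (snd (s ! m))"
    using assms unfolding off_graphs_def piece_def by auto
  define s' where "s' = restr (\<lambda>m. (x m, y m, w m)) (length s + N)"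
  have "s = take (length s) s'"
    by (rule nth_equalityI) (use w(2) in \<open>auto simp: s'_def prod_eq_iff\<close>)
  then have "prefix s s'" by (metis take_is_prefix)
  moreover have "off_graphs h s' x y"
    using assms w(1) unfolding off_graphs_def piece_def s'_def by auto
  ultimately show ?thesis by (intro exI[of _ s']) (simp add: s'_def)
qed

text \<open>
  If no two points over a common \<open>y\<close> lay above \<open>s0\<close>, the points above \<open>s0\<close> over the \<open>y\<close> realizing \<open>A\<close>
  would form an analytic set with one-point sections, and adjoining its graph to \<open>h\<close> would destroy
  the realization of \<open>A\<close>.
\<close>

lemma realized_split:
  assumes h: "\<And>n. h n \<in> cantor_algebra \<rightarrow>\<^sub>M cantor_algebra"
    and max: "\<And>h'. (\<And>n. h' n \<in> cantor_algebra \<rightarrow>\<^sub>M cantor_algebra) \<Longrightarrow> realized h' A"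
    and A: "finite A" "s0 \<in> A"
  shows "\<exists>y x x'. x \<noteq> x' \<and> off_graphs h s0 x y \<and> off_graphs h s0 x' y \<and> (\<forall>s\<in>A. \<exists>x. off_graphs h s x y)"
proof (rule ccontr)
  assume no: "\<not> ?thesis"
  define E where "E = {p. off_graphs h s0 (fst p) (snd p)} \<inter>
    (\<Inter>s\<in>A. snd -` (snd ` {p. off_graphs h s (fst p) (snd p)}))"
  have img: "y \<in> snd ` {p. off_graphs h s (fst p) (snd p)} \<longleftrightarrow> (\<exists>x. off_graphs h s x y)" for s y
    unfolding image_iff by simp
  have E: "(x, y) \<in> E \<longleftrightarrow> off_graphs h s0 x y \<and> (\<forall>s\<in>A. \<exists>x. off_graphs h s x y)" for x y
    unfolding E_def Int_iff INT_iff vimage_eq snd_conv img by simp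
  have vim: "analytic (snd -` B :: (cantor \<times> cantor) set)" if B: "analytic B" for B :: "cantor set"
  proof -
    obtain G :: "(cantor \<times> (nat \<Rightarrow> nat)) set" where G: "closed G" "B = {a. \<exists>w. (a, w) \<in> G}"
      using B unfolding analytic_def by blast
    have "closed ((\<lambda>p :: (cantor \<times> cantor) \<times> (nat \<Rightarrow> nat). (snd (fst p), snd p)) -` G)"
      by (intro closed_vimage G continuous_on_Pair continuous_on_fst continuous_on_snd continuous_on_id)
    from analyticI[OF this] show ?thesis by (simp add: G(2) vimage_def)
  qed
  have "analytic E" unfolding E_def
    by (intro analytic_Int analytic_finite_INT A(1) vim analytic_snd_image analytic_off_graphs h)
  moreover have "x = x'" if "(x, y) \<in> E" "(x', y) \<in> E" for x x' y
  proof -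
    have "\<forall>s\<in>A. \<exists>x. off_graphs h s x y" using that(1) by (simp add: E)
    moreover have "off_graphs h s0 x y" "off_graphs h s0 x' y" using that by (simp_all add: E)
    ultimately show ?thesis using no by blast
  qed
  ultimately obtain g where g: "g \<in> cantor_algebra \<rightarrow>\<^sub>M cantor_algebra" "\<And>x y. (x, y) \<in> E \<Longrightarrow> x = g y"
    using analytic_unique_sections_graph by metis
  have "realized (case_nat g h) A"
    by (rule max) (use g(1) h in \<open>auto split: nat.split\<close>)
  then obtain y where y: "\<forall>s\<in>A. \<exists>x. off_graphs (case_nat g h) s x y" unfolding realized_def by blast
  have off: "off_graphs h s x y \<and> x \<noteq> g y" if o: "off_graphs (case_nat g h) s x y" for s x
  proof -
    have all: "\<forall>n. x \<noteq> case_nat g h n y" using o unfolding off_graphs_def by blast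
    have "x \<noteq> h n y" for n using all[rule_format, of "Suc n"] by simp
    moreover have "x \<noteq> g y" using all[rule_format, of 0] by simp
    ultimately show ?thesis using o unfolding off_graphs_def by blast
  qed
  obtain x where x: "off_graphs (case_nat g h) s0 x y" using y A(2) by blast
  have "\<forall>s\<in>A. \<exists>x. off_graphs h s x y" using y off by blast
  then have "(x, y) \<in> E" using off[OF x] by (simp add: E)
  then show False using g(2) off[OF x] by blast
qed

text \<open>The nodes of \<open>J\<close> are split one at a time. By \<open>max\<close>, each
  intermediate finite set stays realized whatever graphs are used, so \<open>realized_split\<close>
  applies again.\<close>

lemma split_all:
  assumes h: "\<And>n. h n \<in> cantor_algebra \<rightarrow>\<^sub>M cantor_algebra"
    and max: "\<And>A h'. finite A \<Longrightarrow> realized h A \<Longrightarrow> (\<And>n. h' n \<in> cantor_algebra \<rightarrow>\<^sub>M cantor_algebra) \<Longrightarrow> realized h' A"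
    and I: "finite I" "realized h (S ` I)" and J: "finite J" "J \<subseteq> I"
  shows "\<exists>S1 S2. (\<forall>i\<in>I. prefix (S i) (S1 i) \<and> N \<le> length (S1 i)) \<and>
     (\<forall>i\<in>J. prefix (S i) (S2 i) \<and> N \<le> length (S2 i) \<and> apart (S1 i) (S2 i)) \<and> realized h (S1 ` I \<union> S2 ` J)"
  using J
proof (induction J rule: finite_induct)
  case empty
  obtain y where "\<forall>s\<in>S ` I. \<exists>x. off_graphs h s x y" using I(2) unfolding realized_def by blast
  then have "\<forall>i\<in>I. \<exists>s'. prefix (S i) s' \<and> N \<le> length s' \<and> (\<exists>x. off_graphs h s' x y)"
    using off_graphs_extend[where N = N] by (metis image_eqI le_add2)
  then obtain S1 where "\<forall>i\<in>I. prefix (S i) (S1 i) \<and> N \<le> length (S1 i) \<and> (\<exists>x. off_graphs h (S1 i) x y)"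
    by metis
  then show ?case unfolding realized_def by (intro exI[of _ S1]) auto
next
  case (insert j J)
  then obtain S1 S2 where S: "\<forall>i\<in>I. prefix (S i) (S1 i) \<and> N \<le> length (S1 i)"
     "\<forall>i\<in>J. prefix (S i) (S2 i) \<and> N \<le> length (S2 i) \<and> apart (S1 i) (S2 i)" "realized h (S1 ` I \<union> S2 ` J)"
    by auto
  let ?A = "S1 ` I \<union> S2 ` J"
  have fin: "finite ?A" using I(1) insert.hyps(1) by simp
  obtain y x x' where x: "x \<noteq> x'" "off_graphs h (S1 j) x y" "off_graphs h (S1 j) x' y"
      and y: "\<forall>s\<in>?A. \<exists>x. off_graphs h s x y"
    using realized_split[of h, OF h max[OF fin S(3)] fin, of "S1 j"] insert.prems by auto
  obtain k where k: "x k \<noteq> x' k" using x(1) by blast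
  \<comment> \<open>The length lets both strings reach the bit \<open>k\<close> where the two points
    differ, and also exceeds \<open>N\<close>. The other strings are kept, since the same
    \<open>y\<close> realizes them.\<close>
  obtain u where u: "prefix (S1 j) u" "length u = length (S1 j) + (Suc k + N)" "off_graphs h u x y" "\<forall>m<length u. fst (u ! m) = x m"
    using off_graphs_extend[OF x(2)] by blast
  obtain u' where u': "prefix (S1 j) u'" "length u' = length (S1 j) + (Suc k + N)" "off_graphs h u' x' y" "\<forall>m<length u'. fst (u' ! m) = x' m"
    using off_graphs_extend[OF x(3)] by blast
  have apart: "apart u u'" unfolding apart_def by (intro exI[of _ k]) (use k u u' in simp)
  define T1 where "T1 = S1(j := u)"
  define T2 where "T2 = S2(j := u')"
  have T1: "prefix (S1 i) (T1 i) \<and> (\<exists>x. off_graphs h (T1 i) x y)" if "i \<in> I" for i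
    using that y u by (auto simp: T1_def)
  have T2: "i \<noteq> j \<Longrightarrow> T2 i = S2 i" "i \<in> insert j J \<Longrightarrow> \<exists>x. off_graphs h (T2 i) x y" for i
    using y u' by (auto simp: T2_def)
  have pre: "prefix (S i) (T1 i)" if "i \<in> I" for i
    using S(1) T1[OF that] that prefix_order.trans by blast
  have "prefix (S i) (T2 i) \<and> N \<le> length (T2 i) \<and> apart (T1 i) (T2 i)" if "i \<in> insert j J" for i
  proof (cases "i = j")
    case True
    have "prefix (S j) (S1 j)" using S(1) insert.prems by blast
    then have "prefix (S j) u'" using u'(1) prefix_order.trans by blast
    then show ?thesis using True apart u'(2) by (simp add: T1_def T2_def)
  next
    case False
    then show ?thesis using S(2) that T2(1)[OF False] by (simp add: T1_def)
  qed
  moreover have "prefix (S i) (T1 i) \<and> N \<le> length (T1 i)" if "i \<in> I" for i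
    using pre[OF that] T1[OF that] S(1) that by (meson order_trans prefix_length_le)
  moreover have "realized h (T1 ` I \<union> T2 ` insert j J)"
    unfolding realized_def using T1 T2(2) by (intro exI[of _ y]) blast
  ultimately show ?case by (intro exI[of _ T1] exI[of _ T2]) simp
qed

text \<open>Repeated splitting yields a Cantor scheme of strings, each level being realized over a
  single \<open>y\<close>. The branches converge to pairwise distinct points over one limiting
  \<open>y\<close>.\<close>

lemma cantor_scheme_uncountable_section:
  assumes h: "\<And>n. h n \<in> cantor_algebra \<rightarrow>\<^sub>M cantor_algebra"
    and max: "\<And>A h'. finite A \<Longrightarrow> realized h A \<Longrightarrow> (\<And>n. h' n \<in> cantor_algebra \<rightarrow>\<^sub>M cantor_algebra) \<Longrightarrow> realized h' A"
    and start: "realized h {[]}"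
  shows "\<exists>y. uncountable {x. \<exists>w. ((x, y), w) \<in> F}"
proof -
  let ?lev = "\<lambda>n. {u :: bool list. length u = n}"
  have fin: "finite (?lev n)" for n using finite_lists_length_eq[of "UNIV :: bool set" n] by simp
  have "\<exists>S. \<forall>n. realized h (S n ` ?lev n) \<and>
    (\<forall>u\<in>?lev n. \<forall>c. prefix (S n u) (S (Suc n) (u @ [c])) \<and> Suc n \<le> length (S (Suc n) (u @ [c]))) \<and>
    (\<forall>u\<in>?lev n. apart (S (Suc n) (u @ [True])) (S (Suc n) (u @ [False])))"
  proof (rule dependent_nat_choice[of "\<lambda>n S. realized h (S ` ?lev n)"
      "\<lambda>n S S'. (\<forall>u\<in>?lev n. \<forall>c. prefix (S u) (S' (u @ [c])) \<and> Suc n \<le> length (S' (u @ [c]))) \<and>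
        (\<forall>u\<in>?lev n. apart (S' (u @ [True])) (S' (u @ [False])))", simplified conj_assoc])
    show "\<exists>S. realized h (S ` ?lev 0)" using start by (intro exI[of _ "\<lambda>_. []"]) simp
  next
    fix S n assume "realized h (S ` ?lev n)"
    from split_all[OF h max fin this fin order_refl, of "Suc n"]
    obtain S1 S2 where S: "\<forall>i\<in>?lev n. prefix (S i) (S1 i) \<and> Suc n \<le> length (S1 i)"
     "\<forall>i\<in>?lev n. prefix (S i) (S2 i) \<and> Suc n \<le> length (S2 i) \<and> apart (S1 i) (S2 i)" "realized h (S1 ` ?lev n \<union> S2 ` ?lev n)"
      by blast
    \<comment> \<open>The last bit of a node selects one of the two halves of the split.\<close>
    define S' where "S' u = (if last u then S1 (butlast u) else S2 (butlast u))" for u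
    have "S' ` ?lev (Suc n) \<subseteq> S1 ` ?lev n \<union> S2 ` ?lev n"
      by (auto simp: S'_def)
    then have "realized h (S' ` ?lev (Suc n))" using S(3) unfolding realized_def by blast
    then show "\<exists>S'. realized h (S' ` ?lev (Suc n)) \<and>
       (\<forall>u\<in>?lev n. \<forall>c. prefix (S u) (S' (u @ [c])) \<and> Suc n \<le> length (S' (u @ [c]))) \<and>
        (\<forall>u\<in>?lev n. apart (S' (u @ [True])) (S' (u @ [False])))"
      using S(1,2) by (intro exI[of _ S']) (simp add: S'_def)
  qed
  then obtain S where real: "\<And>n. realized h (S n ` ?lev n)"
    and pre: "\<And>n u c. length u = n \<Longrightarrow> prefix (S n u) (S (Suc n) (u @ [c])) \<and> Suc n \<le> length (S (Suc n) (u @ [c]))"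
    and ap: "\<And>n u. length u = n \<Longrightarrow> apart (S (Suc n) (u @ [True])) (S (Suc n) (u @ [False]))"
    by blast
  define B where "B \<alpha> n = S n (restr \<alpha> n)" for \<alpha> :: cantor and n
  have B_step: "prefix (B \<alpha> n) (B \<alpha> (Suc n))" for \<alpha> n using pre[of "restr \<alpha> n" n] by (simp add: B_def)
  have B_len: "n \<le> length (B \<alpha> n)" for \<alpha> n
    using pre[of "restr \<alpha> (n - 1)" "n - 1"] by (cases n) (simp_all add: B_def)
  have B_mono: "n \<le> n' \<Longrightarrow> prefix (B \<alpha> n) (B \<alpha> n')" for \<alpha> n n'
    by (induction n' rule: dec_induct) (use B_step prefix_order.trans in blast)+
  \<comment> \<open>The strings along \<alpha> cohere, and the one at level \<open>Suc m\<close>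
    already has a position \<open>m\<close>.\<close>
  define q where "q \<alpha> m = B \<alpha> (Suc m) ! m" for \<alpha> m
  have q: "B \<alpha> n ! m = q \<alpha> m" if "m < length (B \<alpha> n)" for \<alpha> n m
  proof (cases "n \<le> Suc m")
    case True
    then show ?thesis using B_mono[OF True, of \<alpha>] that by (auto simp: q_def prefix_def nth_append)
  next
    case False
    then have "prefix (B \<alpha> (Suc m)) (B \<alpha> n)" by (intro B_mono) simp
    then show ?thesis using B_len[of "Suc m" \<alpha>] by (auto simp: q_def prefix_def nth_append)
  qed
  obtain Y where Y: "\<And>n s. s \<in> S n ` ?lev n \<Longrightarrow> \<exists>x. off_graphs h s x (Y n)"
    using real unfolding realized_def by metis
  have wit: "\<exists>x w. ((x, Y n), w) \<in> F \<and> (\<forall>m<length (B \<alpha> n). x m = fst (q \<alpha> m) \<and> Y n m = fst (snd (q \<alpha> m)) \<and> w m = snd (snd (q \<alpha> m)))" for \<alpha> n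
  proof -
    have "B \<alpha> n \<in> S n ` ?lev n" by (auto simp: B_def)
    from Y[OF this] show ?thesis unfolding off_graphs_def piece_def using q by auto
  qed
  define y where "y m = Y (Suc m) m" for m
  \<comment> \<open>All strings of level \<open>Suc m\<close> are realized over the common
    \<open>Y (Suc m)\<close> and are longer than \<open>m\<close>, so this bit is the same on every
    branch.\<close>
  have ybit: "fst (snd (q \<alpha> m)) = y m" for \<alpha> m
    using wit[of "Suc m" \<alpha>] B_len[of "Suc m" \<alpha>] by (auto simp: y_def)
  define x where "x \<alpha> m = fst (q \<alpha> m)" for \<alpha> m
  have in_F: "((x \<alpha>, y), (\<lambda>m. snd (snd (q \<alpha> m)))) \<in> F" for \<alpha>
  proof (rule closed_triple_limit[OF closed_F])
    fix n
    obtain x' w' where "((x', Y n), w') \<in> F"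
      "\<forall>m<length (B \<alpha> n). x' m = fst (q \<alpha> m) \<and> Y n m = fst (snd (q \<alpha> m)) \<and> w' m = snd (snd (q \<alpha> m))"
      using wit by blast
    then show "\<exists>x' y' w'. ((x', y'), w') \<in> F \<and> (\<forall>m<n. x' m = x \<alpha> m \<and> y' m = y m \<and> w' m = snd (snd (q \<alpha> m)))"
      using B_len[of n \<alpha>] ybit by (intro exI[of _ x'] exI[of _ "Y n"] exI[of _ w']) (simp add: x_def)
  qed
  have "inj x"
  proof (rule injI, rule ccontr)
    fix \<alpha> \<beta> :: cantor assume eq: "x \<alpha> = x \<beta>" and "\<alpha> \<noteq> \<beta>"
    then have ex: "\<exists>k. \<alpha> k \<noteq> \<beta> k" by blast
    define n where "n = (LEAST k. \<alpha> k \<noteq> \<beta> k)"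
    have n: "\<alpha> n \<noteq> \<beta> n" "\<And>k. k < n \<Longrightarrow> \<alpha> k = \<beta> k"
      using LeastI_ex[OF ex] not_less_Least unfolding n_def by blast+
    have r: "restr \<beta> n = restr \<alpha> n" using n(2) by simp
    have "B \<alpha> (Suc n) = S (Suc n) (restr \<alpha> n @ [\<alpha> n])" "B \<beta> (Suc n) = S (Suc n) (restr \<alpha> n @ [\<beta> n])"
      by (simp_all only: B_def upt_Suc_append[OF le0] map_append r list.map)
    then have "apart (B \<alpha> (Suc n)) (B \<beta> (Suc n)) \<or> apart (B \<beta> (Suc n)) (B \<alpha> (Suc n))"
      using ap[of "restr \<alpha> n" n] n(1) by (cases "\<alpha> n"; cases "\<beta> n") simp_all
    then obtain k where k: "k < length (B \<alpha> (Suc n))" "k < length (B \<beta> (Suc n))" "fst (B \<alpha> (Suc n) ! k) \<noteq> fst (B \<beta> (Suc n) ! k)"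
      unfolding apart_def by metis
    then have "x \<alpha> k \<noteq> x \<beta> k" using q by (simp add: x_def)
    then show False using eq by simp
  qed
  then have "uncountable (range x)"
    using uncountable_cantor countable_image_inj_on by blast
  moreover have "range x \<subseteq> {x. \<exists>w. ((x, y), w) \<in> F}" using in_F by blast
  ultimately show ?thesis using countable_subset by blast
qed

text \<open>
  There are only countably many finite sets of strings, so one sequence \<open>h\<close> of graphs prevents every
  finite set that some sequence can prevent; this replaces the usual transfinite derivative.
\<close>

lemma covered_by_graphs:
  assumes "\<And>y. countable {x. \<exists>w. ((x, y), w) \<in> F}"
  shows "\<exists>h. (\<forall>n::nat. h n \<in> cantor_algebra \<rightarrow>\<^sub>M cantor_algebra) \<and> (\<forall>x y w. ((x, y), w) \<in> F \<longrightarrow> (\<exists>n. x = h n y))"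
proof -
  define bad where "bad l h \<longleftrightarrow> (\<forall>n. h n \<in> cantor_algebra \<rightarrow>\<^sub>M cantor_algebra) \<and> \<not> realized h (set l)" for l and h :: "nat \<Rightarrow> cantor \<Rightarrow> cantor"
  \<comment> \<open>If no measurable family prevents \<open>set l\<close>, an arbitrary measurable
    default is used.\<close>
  define H where "H l = (if \<exists>h. bad l h then SOME h. bad l h else (\<lambda>_ y. y))" for l
  have H: "H l n \<in> cantor_algebra \<rightarrow>\<^sub>M cantor_algebra" for l n
  proof (cases "\<exists>h. bad l h")
    case True
    then have "bad l (H l)" unfolding H_def by (simp add: someI_ex)
    then show ?thesis unfolding bad_def by blast
  qed (simp add: H_def)
  \<comment> \<open>All families \<open>H l\<close> are merged into one sequence. Avoiding
    \<open>h\<close> therefore implies avoiding each \<open>H l\<close>.\<close>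
  define h where "h n = H (from_nat (fst (prod_decode n))) (snd (prod_decode n))" for n
  have hm: "h n \<in> cantor_algebra \<rightarrow>\<^sub>M cantor_algebra" for n unfolding h_def by (rule H)
  have Hh: "H l m = h (prod_encode (to_nat l, m))" for l m by (simp add: h_def)
  have max: "realized h' A"
    if A: "finite A" "realized h A" and h': "\<And>n. h' n \<in> cantor_algebra \<rightarrow>\<^sub>M cantor_algebra" for A h'
  proof (rule ccontr)
    assume no: "\<not> realized h' A"
    obtain l where l: "set l = A" using A(1) finite_list by blast
    then have "bad l h'" using no h' by (simp add: bad_def)
    then have ex: "\<exists>h. bad l h" by (rule exI[of _ h'])
    then have "bad l (H l)" using someI_ex[OF ex] by (simp add: H_def)
    moreover have "realized (H l) A"
      using A(2) unfolding realized_def off_graphs_def Hh by blast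
    ultimately show False using l unfolding bad_def by blast
  qed
  \<comment> \<open>Otherwise the scheme would produce an uncountable section. That the empty string
    is not realized means that no point of the set is off the graphs.\<close>
  have "\<not> realized h {[]}"
    using cantor_scheme_uncountable_section[of h, OF hm max] assms by blast
  then have "\<forall>x y w. ((x, y), w) \<in> F \<longrightarrow> (\<exists>n. x = h n y)"
    unfolding realized_def off_graphs_def piece_def by auto
  then show ?thesis using hm by blast
qed

end

text \<open>The functions are total and only cover the sections; their values may fall outside
  \<open>R\<close>, which is corrected where they are applied.\<close>

theorem lusin_novikov_cover:
  assumes "R \<in> sets cantor2_algebra" "\<And>y. countable {x. (x, y) \<in> R}"
  shows "\<exists>h. (\<forall>n::nat. h n \<in> cantor_algebra \<rightarrow>\<^sub>M cantor_algebra) \<and> (\<forall>x y. (x, y) \<in> R \<longrightarrow> (\<exists>n. x = h n y))"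
proof -
  obtain F :: "((cantor \<times> cantor) \<times> (nat \<Rightarrow> nat)) set" where F: "closed F" "R = {a. \<exists>w. (a, w) \<in> F}"
    using borel_imp_analytic[OF assms(1)] unfolding analytic_def by blast
  interpret closed_representation F by unfold_locales (rule F)
  show ?thesis using covered_by_graphs assms(2) unfolding F(2) by simp
qed

section \<open>A perfect set of independent sequences\<close>

lemma snd_prod_decode_le: "snd (prod_decode n) \<le> n"
  using le_prod_encode_2[of "snd (prod_decode n)" "fst (prod_decode n)"] by simp

text \<open>
  Oracle bits are grouped into columns by \<^const>\<open>prod_encode\<close>; \<open>valid k z \<rho> \<rho>'\<close> says that the bits added to
  \<open>\<rho>\<close> in the columns below \<open>k\<close> copy the corresponding \<open>z i\<close>.
\<close>

definition valid :: "nat \<Rightarrow> (nat \<Rightarrow> cantor) \<Rightarrow> bool list \<Rightarrow> bool list \<Rightarrow> bool" where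
  "valid k z \<rho> \<rho>' \<longleftrightarrow> prefix \<rho> \<rho>' \<and>
     (\<forall>p. length \<rho> \<le> p \<longrightarrow> p < length \<rho>' \<longrightarrow> fst (prod_decode p) < k \<longrightarrow>
        \<rho>' ! p = z (fst (prod_decode p)) (snd (prod_decode p)))"

definition hits :: "rf \<Rightarrow> nat \<Rightarrow> bool list \<Rightarrow> nat \<Rightarrow> (nat \<Rightarrow> cantor) \<Rightarrow> bool list \<Rightarrow> bool list \<Rightarrow> bool" where
  "hits e k \<rho> n z \<rho>' \<tau> \<longleftrightarrow> valid k z \<rho> \<rho>' \<and> length \<tau> = n \<and> outputs e \<rho>' \<tau>"

lemma valid_refl: "valid k z \<rho> \<rho>"
  by (simp add: valid_def)

lemma valid_prefix: "valid k z \<rho> \<rho>' \<Longrightarrow> prefix \<rho> \<rho>'"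
  by (simp add: valid_def)

text \<open>Position \<open>p\<close> copies a bit with index at most \<open>p\<close>, so validity
  depends only on the bits of \<open>z\<close> below the length of the longer string. Finite
  approximations to \<open>z\<close> can thus decide it.\<close>

lemma valid_cong:
  assumes "valid k z \<rho> \<rho>'" "\<And>i m. i < k \<Longrightarrow> m < length \<rho>' \<Longrightarrow> z' i m = z i m"
  shows "valid k z' \<rho> \<rho>'"
  using assms unfolding valid_def by (simp add: le_less_trans[OF snd_prod_decode_le])

lemma hits_cong:
  assumes "hits e k \<rho> n z \<rho>' \<tau>" "\<And>i m. i < k \<Longrightarrow> m < length \<rho>' \<Longrightarrow> z' i m = z i m"
  shows "hits e k \<rho> n z' \<rho>' \<tau>"
  using assms valid_cong unfolding hits_def by blast

lemma valid_trans:
  assumes "valid k z \<rho> \<rho>'" "valid k z \<rho>' \<rho>''"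
  shows "valid k z \<rho> \<rho>''"
  unfolding valid_def
proof (intro conjI allI impI)
  show "prefix \<rho> \<rho>''" using assms valid_prefix prefix_order.trans by blast
  fix p assume p: "length \<rho> \<le> p" "p < length \<rho>''" "fst (prod_decode p) < k"
  show "\<rho>'' ! p = z (fst (prod_decode p)) (snd (prod_decode p))"
  proof (cases "p < length \<rho>'")
    case True
    then have "\<rho>'' ! p = \<rho>' ! p" using valid_prefix[OF assms(2)] by (auto simp: prefix_def nth_append)
    then show ?thesis using assms(1) p True unfolding valid_def by simp
  next
    case False
    then show ?thesis using assms(2) p unfolding valid_def by simp
  qed
qed

lemma valid_mono: "valid k z \<rho> \<rho>' \<Longrightarrow> k' \<le> k \<Longrightarrow> valid k' z \<rho> \<rho>'"
  by (simp add: valid_def)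

lemma valid_between:
  assumes "valid k z \<rho> \<rho>'" "prefix \<rho> \<sigma>" "prefix \<sigma> \<rho>'"
  shows "valid k z \<rho> \<sigma>"
  using assms unfolding valid_def by (auto simp: prefix_def nth_append split: if_splits)

text \<open>Copying the true bit respects every column, so valid strings can always grow.\<close>

lemma valid_snoc: "valid k z \<rho> (\<rho> @ [z (fst (prod_decode (length \<rho>))) (snd (prod_decode (length \<rho>)))])"
  by (auto simp: valid_def nth_append less_Suc_eq)

section \<open>Finite approximations and settling of tasks\<close>

definition agree :: "nat \<Rightarrow> cantor \<Rightarrow> cantor \<Rightarrow> bool" where
  "agree L x x' \<longleftrightarrow> (\<forall>m<L. x m = x' m)"

lemma agree_trans: "agree L x x' \<Longrightarrow> agree L' x' x'' \<Longrightarrow> L \<le> L' \<Longrightarrow> agree L x x''"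
  by (simp add: agree_def)

lemma agree_restr: "agree L x x' \<Longrightarrow> n \<le> L \<Longrightarrow> restr x n = restr x' n"
  by (simp add: agree_def)

definition extends_on :: "bool list set \<Rightarrow> nat \<Rightarrow> (bool list \<Rightarrow> cantor) \<Rightarrow> (bool list \<Rightarrow> cantor) \<Rightarrow> bool" where
  "extends_on V L y y' \<longleftrightarrow> (\<forall>u\<in>V. agree L (y u) (y' u))"

lemma extends_on_refl: "extends_on V L y y"
  by (simp add: extends_on_def agree_def)

lemma extends_on_trans: "extends_on V L y y' \<Longrightarrow> extends_on V L' y' y'' \<Longrightarrow> L \<le> L' \<Longrightarrow> extends_on V L y y''"
  unfolding extends_on_def using agree_trans by blast

text \<open>
  An approximation \<open>(y, L)\<close> fixes the first \<open>L\<close> bits of \<open>y u\<close> for the finitely many nodes \<open>u \<in> V\<close>. It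
  settles the task \<open>(e, \<rho>, us)\<close> at length \<open>n\<close> when \<open>e\<close> cannot produce an output of length \<open>n\<close> from \<open>\<rho>\<close>
  and the branches through \<open>us\<close>, or does produce one which no branch through another node extends.
\<close>

definition settles :: "bool list set \<Rightarrow> rf \<times> bool list \<times> bool list list \<Rightarrow> nat \<Rightarrow> (bool list \<Rightarrow> cantor) \<Rightarrow> nat \<Rightarrow> bool" where
  "settles V t N y L \<longleftrightarrow> (case t of (e, \<rho>, us) \<Rightarrow> \<exists>n. N \<le> n \<and> n \<le> L \<and>
     ((\<exists>y' \<rho>' \<tau>. extends_on V L y y' \<and> hits e (length us) \<rho> n (\<lambda>i. y' (us ! i)) \<rho>' \<tau>) \<longrightarrow>
      (\<exists>\<rho>' \<tau>. (\<forall>y'. extends_on V L y y' \<longrightarrow> hits e (length us) \<rho> n (\<lambda>i. y' (us ! i)) \<rho>' \<tau>) \<and>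
         (\<forall>u\<in>V. u \<notin> set us \<longrightarrow> restr (y u) n \<noteq> \<tau>))))"

text \<open>A finer approximation has fewer completions, and the first \<open>n\<close> bits, with
  \<open>n \<le> L\<close>, are already frozen.\<close>

lemma settles_extend:
  assumes "settles V t N y L" "extends_on V L y y2" "L \<le> L2"
  shows "settles V t N y2 L2"
proof -
  obtain e \<rho> us where t: "t = (e, \<rho>, us)" by (cases t)
  obtain n where n: "N \<le> n" "n \<le> L"
    and c: "\<And>y' \<rho>' \<tau>. extends_on V L y y' \<Longrightarrow> hits e (length us) \<rho> n (\<lambda>i. y' (us ! i)) \<rho>' \<tau> \<Longrightarrow>
      \<exists>\<rho>' \<tau>. (\<forall>y'. extends_on V L y y' \<longrightarrow> hits e (length us) \<rho> n (\<lambda>i. y' (us ! i)) \<rho>' \<tau>) \<and>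
         (\<forall>u\<in>V. u \<notin> set us \<longrightarrow> restr (y u) n \<noteq> \<tau>)"
    using assms(1) unfolding t settles_def prod.case by blast
  have ext: "extends_on V L y y'" if "extends_on V L2 y2 y'" for y'
    using extends_on_trans[OF assms(2) that assms(3)] .
  have r: "restr (y2 u) n = restr (y u) n" if "u \<in> V" for u
    using assms(2) that n(2) agree_restr unfolding extends_on_def by metis
  show ?thesis unfolding t settles_def prod.case
  proof (intro exI[of _ n] conjI impI)
    assume "\<exists>y' \<rho>' \<tau>. extends_on V L2 y2 y' \<and> hits e (length us) \<rho> n (\<lambda>i. y' (us ! i)) \<rho>' \<tau>"
    then obtain \<rho>' \<tau> where "\<And>y'. extends_on V L y y' \<Longrightarrow> hits e (length us) \<rho> n (\<lambda>i. y' (us ! i)) \<rho>' \<tau>"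
         "\<And>u. u\<in>V \<Longrightarrow> u \<notin> set us \<Longrightarrow> restr (y u) n \<noteq> \<tau>" using c ext by metis
    then show "\<exists>\<rho>' \<tau>. (\<forall>y'. extends_on V L2 y2 y' \<longrightarrow> hits e (length us) \<rho> n (\<lambda>i. y' (us ! i)) \<rho>' \<tau>) \<and>
         (\<forall>u\<in>V. u \<notin> set us \<longrightarrow> restr (y2 u) n \<noteq> \<tau>)"
      using ext r by (intro exI[of _ \<rho>'] exI[of _ \<tau>]) presburger
  qed (use n assms(3) in auto)
qed

lemma settles_weaken: "settles V t N y L \<Longrightarrow> N' \<le> N \<Longrightarrow> settles V t N' y L"
  unfolding settles_def case_prod_beta
  by (elim exE conjE, intro exI conjI) (rule order_trans, assumption+)

text \<open>If some completion gives an output \<tau> of length \<open>Suc L\<close>, the branches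
  through \<open>us\<close> are frozen far enough to preserve it, and every other branch is turned
  away from \<tau> at its free bit \<open>L\<close>. Otherwise the impossibility is itself
  settled.\<close>

lemma settle_task:
  assumes us: "set us \<subseteq> V"
  shows "\<exists>y2 L2. L \<le> L2 \<and> extends_on V L y y2 \<and> settles V (e, \<rho>, us) L y2 L2"
proof (cases "\<exists>y' \<rho>' \<tau>. extends_on V L y y' \<and> hits e (length us) \<rho> (Suc L) (\<lambda>i. y' (us ! i)) \<rho>' \<tau>")
  case False
  have "settles V (e, \<rho>, us) L y (Suc L)"
    unfolding settles_def prod.case
  proof (intro exI[of _ "Suc L"] conjI impI)
    assume "\<exists>y' \<rho>' \<tau>. extends_on V (Suc L) y y' \<and> hits e (length us) \<rho> (Suc L) (\<lambda>i. y' (us ! i)) \<rho>' \<tau>"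
    then have False using False extends_on_trans[OF extends_on_refl, of V "Suc L" y _ L] by (metis le_SucI order_refl)
    then show "\<exists>\<rho>' \<tau>. (\<forall>y'. extends_on V (Suc L) y y' \<longrightarrow> hits e (length us) \<rho> (Suc L) (\<lambda>i. y' (us ! i)) \<rho>' \<tau>) \<and>
         (\<forall>u\<in>V. u \<notin> set us \<longrightarrow> restr (y u) (Suc L) \<noteq> \<tau>)" ..
  qed auto
  then show ?thesis using extends_on_refl by (intro exI[of _ y] exI[of _ "Suc L"]) auto
next
  case True
  then obtain y' \<rho>' \<tau> where y': "extends_on V L y y'" and hit: "hits e (length us) \<rho> (Suc L) (\<lambda>i. y' (us ! i)) \<rho>' \<tau>"
    by blast
  define y2 where "y2 u = (if u \<in> set us then y' u else (y u)(L := \<not> \<tau> ! L))" for u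
  \<comment> \<open>This covers both the flipped bit and every bit that \<rho>' may copy.\<close>
  define L2 where "L2 = max (Suc L) (length \<rho>')"
  have "extends_on V L y y2" using y' by (simp add: extends_on_def y2_def agree_def)
  moreover have "settles V (e, \<rho>, us) L y2 L2"
    unfolding settles_def prod.case
  proof (intro exI[of _ "Suc L"] conjI impI)
    have "hits e (length us) \<rho> (Suc L) (\<lambda>i. y'' (us ! i)) \<rho>' \<tau>" if y'': "extends_on V L2 y2 y''" for y''
    proof (rule hits_cong[OF hit])
      fix i m assume im: "i < length us" "m < length \<rho>'"
      then have "us ! i \<in> V" "us ! i \<in> set us" using us by auto
      then show "y'' (us ! i) m = y' (us ! i) m"
        using y'' im unfolding extends_on_def agree_def y2_def L2_def by (metis less_max_iff_disj)
    qed
    moreover have "restr (y2 u) (Suc L) \<noteq> \<tau>" if "u \<notin> set us" for u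
    proof
      assume "restr (y2 u) (Suc L) = \<tau>"
      then have "\<tau> ! L = y2 u L" by (metis add_0 lessI nth_map_upt diff_zero)
      then show False using that by (simp add: y2_def)
    qed
    ultimately show "\<exists>\<rho>' \<tau>. (\<forall>y'. extends_on V L2 y2 y' \<longrightarrow> hits e (length us) \<rho> (Suc L) (\<lambda>i. y' (us ! i)) \<rho>' \<tau>) \<and>
         (\<forall>u\<in>V. u \<notin> set us \<longrightarrow> restr (y2 u) (Suc L) \<noteq> \<tau>)" by (intro exI[of _ \<rho>'] exI[of _ \<tau>]) simp
  qed (auto simp: L2_def)
  ultimately show ?thesis by (intro exI[of _ y2] exI[of _ L2]) (simp add: L2_def)
qed

lemma settle_finitely_many:
  assumes "finite Ts" "\<And>t. t \<in> Ts \<Longrightarrow> set (snd (snd t)) \<subseteq> V"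
  shows "\<exists>y2 L2. L \<le> L2 \<and> extends_on V L y y2 \<and> (\<forall>t\<in>Ts. settles V t L y2 L2)"
  using assms
proof (induction rule: finite_induct)
  case empty
  show ?case using extends_on_refl by (intro exI[of _ y] exI[of _ L]) auto
next
  case (insert t Ts)
  have "\<And>t. t \<in> Ts \<Longrightarrow> set (snd (snd t)) \<subseteq> V" using insert.prems by blast
  from insert.IH[OF this]
  obtain y2 L2 where 2: "L \<le> L2" "extends_on V L y y2" "\<forall>t\<in>Ts. settles V t L y2 L2" by blast
  obtain e \<rho> us where t: "t = (e, \<rho>, us)" by (cases t)
  then have "set us \<subseteq> V" using insert.prems[of t] by simp
  from settle_task[OF this, of L2 y2 e \<rho>]
  obtain y3 L3 where 3: "L2 \<le> L3" "extends_on V L2 y2 y3" "settles V t L2 y3 L3" unfolding t by auto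
  have "\<forall>t\<in>insert t Ts. settles V t L y3 L3"
    using settles_weaken[OF 3(3) 2(1)] 2(3) settles_extend 3(1,2) by blast
  then show ?case using 2 3 extends_on_trans by (intro exI[of _ y3] exI[of _ L3]) (meson order_trans)
qed

section \<open>Stages of the fusion construction\<close>

definition level :: "nat \<Rightarrow> bool list set" where
  "level s = {u. length u = s}"

text \<open>Bounding the code of \<open>(e, \<rho>, length us)\<close> keeps each stage finite, yet
  every such triple is treated at all late stages, with all choices of nodes.\<close>

definition stage_tasks :: "nat \<Rightarrow> (rf \<times> bool list \<times> bool list list) set" where
  "stage_tasks s = {(e, \<rho>, us). to_nat (e, \<rho>, length us) \<le> s \<and> set us \<subseteq> level (Suc s)}"

lemma finite_level: "finite (level s)"
  unfolding level_def using finite_lists_length_eq[of "UNIV :: bool set" s] by simp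

lemma finite_stage_tasks: "finite (stage_tasks s)"
proof (rule finite_subset)
  let ?c = "\<lambda>t. from_nat t :: rf \<times> bool list \<times> nat"
  show "stage_tasks s \<subseteq> (\<Union>t\<in>{..s}. (\<lambda>us. (fst (?c t), fst (snd (?c t)), us)) `
      {us. set us \<subseteq> level (Suc s) \<and> length us = snd (snd (?c t))})"
  proof
    fix t assume "t \<in> stage_tasks s"
    then obtain e \<rho> us where t: "t = (e, \<rho>, us)" "to_nat (e, \<rho>, length us) \<le> s" "set us \<subseteq> level (Suc s)"
      unfolding stage_tasks_def by auto
    then show "t \<in> (\<Union>t\<in>{..s}. (\<lambda>us. (fst (?c t), fst (snd (?c t)), us)) `
      {us. set us \<subseteq> level (Suc s) \<and> length us = snd (snd (?c t))})"
      by (intro UN_I[of "to_nat (e, \<rho>, length us)"]) simp_all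
  qed
qed (intro finite_UN_I finite_imageI finite_lists_length_eq finite_level finite_atMost)

lemma next_approximation:
  "\<exists>y' L'. L < L' \<and> (\<forall>u\<in>level s. \<forall>c. agree L (y u) (y' (u @ [c])) \<and> y' (u @ [c]) L = c) \<and>
     (\<forall>t\<in>stage_tasks s. settles (level (Suc s)) t L y' L')"
proof -
  \<comment> \<open>A child copies its parent and records its last bit at position \<open>L\<close>;
    settling from \<open>Suc L\<close> onwards leaves that bit untouched.\<close>
  define y1 where "y1 v = (y (butlast v))(L := last v)" for v
  obtain y2 L2 where 2: "Suc L \<le> L2" "extends_on (level (Suc s)) (Suc L) y1 y2"
      "\<forall>t\<in>stage_tasks s. settles (level (Suc s)) t (Suc L) y2 L2"
    using settle_finitely_many[OF finite_stage_tasks, of s "level (Suc s)" "Suc L" y1]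
    unfolding stage_tasks_def by auto
  have "agree L (y u) (y2 (u @ [c])) \<and> y2 (u @ [c]) L = c" if "u \<in> level s" for u c
  proof -
    have "agree (Suc L) (y1 (u @ [c])) (y2 (u @ [c]))"
      using 2(2) that unfolding extends_on_def level_def by simp
    then have "y1 (u @ [c]) m = y2 (u @ [c]) m" if "m < Suc L" for m using that by (simp add: agree_def)
    from this[of L] this[OF less_SucI] show ?thesis by (simp add: agree_def y1_def)
  qed
  moreover have "\<forall>t\<in>stage_tasks s. settles (level (Suc s)) t L y2 L2"
    using 2(3) settles_weaken by (meson le_SucI order_refl)
  ultimately show ?thesis using 2(1) by (intro exI[of _ y2] exI[of _ L2]) auto
qed

text \<open>A condition on finitely many bits is a countable union of cylinders, whatever
  \<open>Q\<close> is.\<close>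

lemma pred_restr_cantor: "Measurable.pred cantor_algebra (\<lambda>x. Q (restr x n))"
proof -
  have "Q (restr x n) \<longleftrightarrow> (\<exists>u. Q u \<and> length u = n \<and> (\<forall>m\<in>{..<n}. x m = u ! m))" for x
  proof
    assume "\<exists>u. Q u \<and> length u = n \<and> (\<forall>m\<in>{..<n}. x m = u ! m)"
    then obtain u where u: "Q u" "length u = n" "\<forall>m<n. x m = u ! m" by auto
    then have "restr x n = u" by (intro nth_equalityI) auto
    then show "Q (restr x n)" using u by simp
  qed (auto intro!: exI[of _ "restr x n"])
  moreover have "Measurable.pred cantor_algebra (\<lambda>x. \<exists>u. Q u \<and> length u = n \<and> (\<forall>m\<in>{..<n}. x m = u ! m))"
    by measurable
  ultimately show ?thesis by simp
qed

text \<open>The length \<open>n\<close> may be taken beyond any \<open>N\<close>. The application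
  takes for \<open>N\<close> the length of an output already incompatible with every
  \<open>z i\<close>, which excludes the last alternative.\<close>

definition avoiding :: "(cantor \<Rightarrow> cantor) \<Rightarrow> bool" where
  "avoiding g \<longleftrightarrow> (\<forall>e \<rho> k z N. (\<forall>i<k. z i \<in> range g) \<longrightarrow> (\<exists>n\<ge>N.
     (\<exists>\<rho>' \<tau>. hits e k \<rho> n z \<rho>' \<tau>) \<longrightarrow>
     (\<exists>\<rho>' \<tau>. hits e k \<rho> n z \<rho>' \<tau> \<and> ((\<exists>x. \<tau> = restr (g x) n) \<longrightarrow> (\<exists>i<k. \<tau> = restr (z i) n)))))"

lemma separating_length:
  fixes x :: "nat \<Rightarrow> cantor"
  shows "\<exists>s0. \<forall>s\<ge>s0. \<forall>i<k. \<forall>j<k. restr (x i) s = restr (x j) s \<longrightarrow> x i = x j"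
proof -
  have "\<exists>d. x i \<noteq> x j \<longrightarrow> x i d \<noteq> x j d" for i j by (auto simp: fun_eq_iff)
  then obtain d where d: "\<And>i j. x i \<noteq> x j \<Longrightarrow> x i (d i j) \<noteq> x j (d i j)" by metis
  define s0 where "s0 = Suc (Max (insert 0 ((\<lambda>(i, j). d i j) ` ({..<k} \<times> {..<k}))))"
  have "d i j < s0" if "i < k" "j < k" for i j
    unfolding s0_def less_Suc_eq_le by (rule Max_ge) (use that in auto)
  then show ?thesis using d unfolding restr_eq_iff by (intro exI[of _ s0]) (meson order_less_le_trans)
qed

text \<open>\<open>g x\<close> is the limit of the approximations along the branch \<open>x\<close>.
  Its bit at position \<open>L s\<close> is \<open>x s\<close>, whence injectivity. Avoidance holds
  because the relevant task is settled at a sufficiently late stage.\<close>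

theorem exists_avoiding_map:
  "\<exists>g. g \<in> cantor_algebra \<rightarrow>\<^sub>M cantor_algebra \<and> inj g \<and> avoiding g"
proof -
  have "\<exists>f. \<forall>s. True \<and> (snd (f s) < snd (f (Suc s)) \<and> (\<forall>u\<in>level s. \<forall>c. agree (snd (f s)) (fst (f s) u) (fst (f (Suc s)) (u @ [c])) \<and>
        fst (f (Suc s)) (u @ [c]) (snd (f s)) = c) \<and>
     (\<forall>t\<in>stage_tasks s. settles (level (Suc s)) t (snd (f s)) (fst (f (Suc s))) (snd (f (Suc s)))))"
    (is "\<exists>f. \<forall>s. True \<and> ?Q s (f s) (f (Suc s))")
  proof (rule dependent_nat_choice[of "\<lambda>_ _. True" ?Q])
    fix p :: "(bool list \<Rightarrow> cantor) \<times> nat" and s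
    show "\<exists>q. True \<and> ?Q s p q" using next_approximation[of "snd p" s "fst p"] by auto
  qed simp
  then obtain f where f: "\<And>s. ?Q s (f s) (f (Suc s))" by blast
  define Y where "Y s = fst (f s)" for s
  define L where "L s = snd (f s)" for s
  have L_step: "L s < L (Suc s)" and Y_step: "u \<in> level s \<Longrightarrow> agree (L s) (Y s u) (Y (Suc s) (u @ [c]))"
    and Y_bit: "u \<in> level s \<Longrightarrow> Y (Suc s) (u @ [c]) (L s) = c"
    and settle: "t \<in> stage_tasks s \<Longrightarrow> settles (level (Suc s)) t (L s) (Y (Suc s)) (L (Suc s))" for s u c t
    using f[of s] unfolding Y_def L_def by auto
  have L_mono: "s \<le> s' \<Longrightarrow> L s \<le> L s'" for s s' using L_step lift_Suc_mono_le[of L] by (meson less_imp_le)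
  have L_ge: "s \<le> L s" for s
  proof (induction s)
    case (Suc s)
    then show ?case using L_step[of s] by simp
  qed simp
  \<comment> \<open>Bit \<open>m\<close> is final at stage \<open>Suc m\<close>, because
    \<open>L (Suc m) > m\<close>.\<close>
  define g where "g x m = Y (Suc m) (restr x (Suc m)) m" for x m
  have lev: "restr x s \<in> level s" for x s by (simp add: level_def)
  have chain: "s \<le> s' \<Longrightarrow> agree (L s) (Y s (restr x s)) (Y s' (restr x s'))" for x s s'
  proof (induction s' rule: dec_induct)
    case base
    show ?case by (simp add: agree_def)
  next
    case (step s')
    then show ?case using agree_trans[OF step.IH Y_step[OF lev, of s' x "x s'"] L_mono] by simp
  qed
  have gY: "agree (L s) (Y s (restr x s)) (g x)" for x s
    unfolding agree_def
  proof (intro allI impI)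
    fix m assume m: "m < L s"
    have "m < L (Suc m)" using L_ge[of "Suc m"] by simp
    show "Y s (restr x s) m = g x m"
    proof (cases "s \<le> Suc m")
      case True
      then show ?thesis using chain[OF True, of x] m unfolding agree_def g_def by blast
    next
      case False
      then have "Suc m \<le> s" by simp
      from chain[OF this, of x] show ?thesis using \<open>m < L (Suc m)\<close> unfolding agree_def g_def by metis
    qed
  qed
  have g_bit: "g x (L s) = x s" for x s
    using gY[of "Suc s" x] L_step[of s] Y_bit[OF lev, of s x "x s"] unfolding agree_def by auto
  have "inj g"
  proof (rule injI)
    fix x x' assume "g x = g x'"
    then have "x s = x' s" for s using g_bit by metis
    then show "x = x'" by (rule ext)
  qed
  moreover have "g \<in> cantor_algebra \<rightarrow>\<^sub>M cantor_algebra"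
    unfolding g_def by (rule measurable_into_cantor) (rule pred_restr_cantor)
  moreover have "avoiding g"
    unfolding avoiding_def
  proof (intro allI impI)
    fix e :: rf and \<rho> :: "bool list" and k N :: nat and z :: "nat \<Rightarrow> cantor" assume z: "\<forall>i<k. z i \<in> range g"
    then have "\<forall>i. \<exists>x. i < k \<longrightarrow> z i = g x" by blast
    then obtain x where x: "\<And>i. i < k \<Longrightarrow> z i = g (x i)" by metis
    obtain s0 where s0: "\<And>s i j. s \<ge> s0 \<Longrightarrow> i < k \<Longrightarrow> j < k \<Longrightarrow> restr (x i) s = restr (x j) s \<Longrightarrow> x i = x j"
      using separating_length[of k x] by blast
    \<comment> \<open>At this stage the task is listed, distinct \<open>x i\<close> pass through
      distinct nodes, and the settled length is at least \<open>N\<close>.\<close>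
    define s where "s = max N (max s0 (to_nat (e, \<rho>, k)))"
    define us where "us = map (\<lambda>i. restr (x i) (Suc s)) [0..<k]"
    have len: "length us = k" by (simp add: us_def)
    have us_nth: "us ! i = restr (x i) (Suc s)" if "i < k" for i using that by (simp add: us_def)
    have us_set: "set us = (\<lambda>i. restr (x i) (Suc s)) ` {..<k}" unfolding us_def by (simp add: atLeast0LessThan)
    have "set us \<subseteq> level (Suc s)" unfolding us_set using lev by blast
    then have "(e, \<rho>, us) \<in> stage_tasks s"
      by (simp add: stage_tasks_def len s_def)
    then have "settles (level (Suc s)) (e, \<rho>, us) (L s) (Y (Suc s)) (L (Suc s))" by (rule settle)
    then obtain n where n: "L s \<le> n" "n \<le> L (Suc s)"
      and c: "\<And>y' \<rho>' \<tau>. extends_on (level (Suc s)) (L (Suc s)) (Y (Suc s)) y' \<Longrightarrow> hits e k \<rho> n (\<lambda>i. y' (us ! i)) \<rho>' \<tau> \<Longrightarrow>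
      \<exists>\<rho>' \<tau>. (\<forall>y'. extends_on (level (Suc s)) (L (Suc s)) (Y (Suc s)) y' \<longrightarrow> hits e k \<rho> n (\<lambda>i. y' (us ! i)) \<rho>' \<tau>) \<and>
         (\<forall>u\<in>level (Suc s). u \<notin> set us \<longrightarrow> restr (Y (Suc s) u) n \<noteq> \<tau>)"
      unfolding settles_def prod.case len by blast
    \<comment> \<open>Several indices may share a node, but by the choice of \<open>s0\<close> they
      then have the same \<open>x i\<close>. Hence \<open>y'\<close> is a completion taking the
      value \<open>z i\<close> at each \<open>us ! i\<close>.\<close>
    define idx where "idx u = (SOME i. i < k \<and> u = restr (x i) (Suc s))" for u
    define y' where "y' u = (if u \<in> set us then g (x (idx u)) else Y (Suc s) u)" for u
    have idx: "idx u < k \<and> u = restr (x (idx u)) (Suc s)" if "u \<in> set us" for u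
      unfolding idx_def by (rule someI_ex) (use that us_set in auto)
    have y'_us: "y' (us ! i) = z i" if i: "i < k" for i
    proof -
      have mem: "us ! i \<in> set us" using i len by simp
      have "restr (x (idx (us ! i))) (Suc s) = restr (x i) (Suc s)" using idx[OF mem] us_nth[OF i] by simp
      then have "x (idx (us ! i)) = x i"
        by (rule s0[rotated -1]) (use idx[OF mem] i in \<open>auto simp: s_def\<close>)
      then show ?thesis using mem x[OF i] by (simp add: y'_def)
    qed
    have y'_ext: "extends_on (level (Suc s)) (L (Suc s)) (Y (Suc s)) y'"
      unfolding extends_on_def
    proof
      fix u
      show "agree (L (Suc s)) (Y (Suc s) u) (y' u)"
        using gY[of "Suc s" "x (idx u)"] idx[of u] by (cases "u \<in> set us") (auto simp: y'_def agree_def)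
    qed
    have transfer: "hits e k \<rho> n (\<lambda>i. y' (us ! i)) \<rho>' \<tau> \<longleftrightarrow> hits e k \<rho> n z \<rho>' \<tau>" for \<rho>' \<tau>
      using hits_cong[of e k \<rho> n _ \<rho>' \<tau>] y'_us by metis
    show "\<exists>n\<ge>N. (\<exists>\<rho>' \<tau>. hits e k \<rho> n z \<rho>' \<tau>) \<longrightarrow>
     (\<exists>\<rho>' \<tau>. hits e k \<rho> n z \<rho>' \<tau> \<and> ((\<exists>x. \<tau> = restr (g x) n) \<longrightarrow> (\<exists>i<k. \<tau> = restr (z i) n)))"
    proof (intro exI[of _ n] conjI impI)
      show "N \<le> n" using n(1) L_ge[of s] by (simp add: s_def)
      assume "\<exists>\<rho>' \<tau>. hits e k \<rho> n z \<rho>' \<tau>"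
      then obtain \<rho>0 \<tau>0 where "hits e k \<rho> n z \<rho>0 \<tau>0" by blast
      then have "hits e k \<rho> n (\<lambda>i. y' (us ! i)) \<rho>0 \<tau>0" by (simp only: transfer)
      from c[OF y'_ext this] obtain \<rho>' \<tau> where h: "\<And>y'. extends_on (level (Suc s)) (L (Suc s)) (Y (Suc s)) y' \<Longrightarrow> hits e k \<rho> n (\<lambda>i. y' (us ! i)) \<rho>' \<tau>"
        and av: "\<And>u. u\<in>level (Suc s) \<Longrightarrow> u \<notin> set us \<Longrightarrow> restr (Y (Suc s) u) n \<noteq> \<tau>"
        by (elim exE conjE) blast
      have gr: "restr (Y (Suc s) (restr a (Suc s))) n = restr (g a) n" for a
        using agree_restr[OF gY n(2)] .
      have "\<exists>i<k. \<tau> = restr (z i) n" if \<tau>: "\<tau> = restr (g a) n" for a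
      proof -
        \<comment> \<open>By \<open>av\<close>, a branch through \<tau> can only run through a node
          of \<open>us\<close>, which is also a node of some \<open>x i\<close>.\<close>
        have "restr a (Suc s) \<in> set us" using av[OF lev] gr \<tau> by metis
        then obtain i where i: "i < k" "restr a (Suc s) = restr (x i) (Suc s)" using idx by blast
        then have "\<tau> = restr (g (x i)) n" using gr \<tau> by metis
        then show ?thesis using x i(1) by metis
      qed
      then show "\<exists>\<rho>' \<tau>. hits e k \<rho> n z \<rho>' \<tau> \<and> ((\<exists>x. \<tau> = restr (g x) n) \<longrightarrow> (\<exists>i<k. \<tau> = restr (z i) n))"
        using h[OF y'_ext] unfolding transfer by (intro exI[of _ \<rho>'] exI[of _ \<tau>] conjI impI) auto
    qed
  qed
  ultimately show ?thesis by blast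
qed

section \<open>Upper bounds computing prescribed elements of the perfect set\<close>

locale avoiding_map =
  fixes g :: "cantor \<Rightarrow> cantor"
  assumes g_measurable: "g \<in> cantor_algebra \<rightarrow>\<^sub>M cantor_algebra"
    and g_inj: "inj g"
    and g_avoiding: "avoiding g"
begin

text \<open>
  Every clause quantifies over finite strings only, which keeps \<open>decided\<close> Borel in \<open>z\<close>.
\<close>

definition decided :: "rf \<Rightarrow> nat \<Rightarrow> (nat \<Rightarrow> cantor) \<Rightarrow> bool list \<Rightarrow> bool" where
  "decided e k z \<rho> \<longleftrightarrow>
     (\<forall>\<rho>' \<tau>. valid k z \<rho> \<rho>' \<longrightarrow> outputs e \<rho>' \<tau> \<longrightarrow> (\<exists>i\<in>{..<k}. \<forall>m\<in>{..<length \<tau>}. \<tau> ! m = z i m)) \<or>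
     (\<exists>n. \<forall>\<rho>' \<tau>. valid k z \<rho> \<rho>' \<longrightarrow> length \<tau> = n \<longrightarrow> \<not> outputs e \<rho>' \<tau>) \<or>
     (\<exists>\<tau>. outputs e \<rho> \<tau> \<and> (\<forall>x. \<tau> \<noteq> restr (g x) (length \<tau>)))"

text \<open>If an extension outputs \<tau>1 disagreeing with every \<open>z i\<close>,
  \<open>avoiding\<close> is applied above it. Either some length is unattainable, or a longer
  output extends \<tau>1, hence is a segment of no \<open>z i\<close> and so leaves the tree of the
  range of \<open>g\<close>.\<close>

lemma decided_dense:
  assumes z: "\<forall>i<k. z i \<in> range g"
  shows "\<exists>\<rho>'. valid k z \<rho> \<rho>' \<and> decided e k z \<rho>'"
proof (cases "\<forall>\<rho>' \<tau>. valid k z \<rho> \<rho>' \<longrightarrow> outputs e \<rho>' \<tau> \<longrightarrow> (\<exists>i\<in>{..<k}. \<forall>m\<in>{..<length \<tau>}. \<tau> ! m = z i m)")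
  case True
  then show ?thesis using valid_refl unfolding decided_def by blast
next
  case False
  then obtain \<rho>1 \<tau>1 where 1: "valid k z \<rho> \<rho>1" "outputs e \<rho>1 \<tau>1" "\<And>i. i < k \<Longrightarrow> \<exists>m<length \<tau>1. \<tau>1 ! m \<noteq> z i m"
    by (metis lessThan_iff)
  obtain n where n: "length \<tau>1 \<le> n" "(\<exists>\<rho>' \<tau>. hits e k \<rho>1 n z \<rho>' \<tau>) \<Longrightarrow>
     (\<exists>\<rho>' \<tau>. hits e k \<rho>1 n z \<rho>' \<tau> \<and> ((\<exists>x. \<tau> = restr (g x) n) \<longrightarrow> (\<exists>i<k. \<tau> = restr (z i) n)))"
    using g_avoiding[unfolded avoiding_def, rule_format, of k z "length \<tau>1" e \<rho>1] z by blast
  show ?thesis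
  proof (cases "\<exists>\<rho>' \<tau>. hits e k \<rho>1 n z \<rho>' \<tau>")
    case False
    then have "\<forall>\<rho>' \<tau>. valid k z \<rho>1 \<rho>' \<longrightarrow> length \<tau> = n \<longrightarrow> \<not> outputs e \<rho>' \<tau>"
      unfolding hits_def by blast
    then have "decided e k z \<rho>1" unfolding decided_def by blast
    then show ?thesis using 1(1) by blast
  next
    case True
    from n(2)[OF this] obtain \<rho>2 \<tau>2 where 2: "valid k z \<rho>1 \<rho>2" "length \<tau>2 = n" "outputs e \<rho>2 \<tau>2"
      "(\<exists>x. \<tau>2 = restr (g x) n) \<Longrightarrow> (\<exists>i<k. \<tau>2 = restr (z i) n)" unfolding hits_def by blast
    have "outputs e \<rho>2 \<tau>1" using outputs_prefix[OF 1(2) valid_prefix[OF 2(1)]] .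
    \<comment> \<open>Both strings are outputs from \<rho>2, so \<tau>2 extends \<tau>1.\<close>
    then have t: "take (length \<tau>1) \<tau>2 = \<tau>1"
      by (rule outputs_unique[OF outputs_take[OF 2(3)]]) (use 2(2) n(1) in simp)
    have "\<tau>2 \<noteq> restr (z i) n" if i: "i < k" for i
    proof
      assume eq: "\<tau>2 = restr (z i) n"
      obtain m where m: "m < length \<tau>1" "\<tau>1 ! m \<noteq> z i m" using 1(3)[OF i] by blast
      have "\<tau>1 ! m = \<tau>2 ! m" using nth_take[OF m(1), of \<tau>2] t by simp
      also have "\<dots> = z i m" using m(1) n(1) by (simp add: eq)
      finally show False using m(2) by simp
    qed
    then have "\<forall>x. \<tau>2 \<noteq> restr (g x) (length \<tau>2)" using 2(2,4) by auto
    then have "decided e k z \<rho>2" unfolding decided_def using 2(3) by blast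
    then show ?thesis using valid_trans[OF 1(1) 2(1)] by blast
  qed
qed

section \<open>The finite-extension construction\<close>

definition step :: "nat \<Rightarrow> (nat \<Rightarrow> cantor) \<Rightarrow> bool list \<Rightarrow> bool list \<Rightarrow> bool" where
  "step j z \<rho> \<rho>' \<longleftrightarrow> valid j z \<rho> \<rho>' \<and> length \<rho> < length \<rho>' \<and> decided (from_nat j) j z \<rho>'"

lemma step_exists:
  assumes "\<forall>i. z i \<in> range g"
  shows "\<exists>\<rho>'. step j z \<rho> \<rho>'"
proof -
  \<comment> \<open>Appending one correctly copied bit first guarantees strict growth.\<close>
  let ?\<sigma> = "\<rho> @ [z (fst (prod_decode (length \<rho>))) (snd (prod_decode (length \<rho>)))]"
  obtain \<rho>' where r: "valid j z ?\<sigma> \<rho>'" "decided (from_nat j) j z \<rho>'"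
    using decided_dense[of j z ?\<sigma> "from_nat j"] assms by blast
  have "valid j z \<rho> \<rho>'" using valid_trans[OF valid_snoc r(1)] .
  moreover have "length \<rho> < length \<rho>'" using prefix_length_le[OF valid_prefix[OF r(1)]] by simp
  ultimately show ?thesis using r(2) unfolding step_def by blast
qed

text \<open>Taking the extension with least code makes the construction canonical, so that it
  depends on \<open>z\<close> in a Borel way.\<close>

primrec stage :: "(nat \<Rightarrow> cantor) \<Rightarrow> nat \<Rightarrow> bool list" where
  "stage z 0 = []"
| "stage z (Suc j) = from_nat (LEAST c. step j z (stage z j) (from_nat c))"

text \<open>For \<open>z\<close> in the range of \<open>g\<close>, stage \<open>Suc p\<close> has
  length at least \<open>Suc p\<close>, so the lookup is within the string.\<close>

definition bound :: "(nat \<Rightarrow> cantor) \<Rightarrow> cantor" where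
  "bound z p = stage z (Suc p) ! p"

lemma stage_step:
  assumes "\<forall>i. z i \<in> range g"
  shows "step j z (stage z j) (stage z (Suc j))"
proof -
  obtain \<rho>' where "step j z (stage z j) \<rho>'" using step_exists[OF assms] by blast
  then have "step j z (stage z j) (from_nat (to_nat \<rho>'))" by simp
  then show ?thesis unfolding stage.simps by (rule LeastI)
qed

lemma stage_length: "\<forall>i. z i \<in> range g \<Longrightarrow> j \<le> length (stage z j)"
proof (induction j)
  case (Suc j)
  then show ?case using stage_step[OF Suc.prems, of j] unfolding step_def by simp
qed simp

text \<open>Step \<open>j'\<close> respects all columns below \<open>j'\<close>, hence those frozen
  at any earlier \<open>j\<close>.\<close>

lemma stage_valid:
  assumes "\<forall>i. z i \<in> range g" "j \<le> j'"
  shows "valid j z (stage z j) (stage z j')"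
  using assms(2)
proof (induction j' rule: dec_induct)
  case (step j')
  have "valid j z (stage z j') (stage z (Suc j'))"
    using stage_step[OF assms(1), of j'] step.hyps(1) valid_mono unfolding step_def by blast
  then show ?case using step.IH valid_trans by blast
qed (rule valid_refl)

lemma restr_bound:
  assumes z: "\<forall>i. z i \<in> range g" and u: "u \<le> length (stage z j)"
  shows "restr (bound z) u = take u (stage z j)"
proof (rule nth_equalityI)
  fix p assume "p < length (restr (bound z) u)"
  then have p: "p < u" by simp
  have l: "p < length (stage z (Suc p))" using stage_length[OF z, of "Suc p"] by simp
  have "stage z (Suc p) ! p = stage z j ! p"
  proof (cases "Suc p \<le> j")
    case True
    then show ?thesis using valid_prefix[OF stage_valid[OF z True]] l by (auto simp: prefix_def nth_append)
  next
    case False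
    then have "j \<le> Suc p" by simp
    from valid_prefix[OF stage_valid[OF z this]] show ?thesis using p u by (auto simp: prefix_def nth_append)
  qed
  then show "restr (bound z) u ! p = take u (stage z j) ! p" using p by (simp add: bound_def)
qed (use u in simp)

lemma bound_valid:
  assumes z: "\<forall>i. z i \<in> range g" and u: "length (stage z j) \<le> u"
  shows "valid j z (stage z j) (restr (bound z) u)"
proof (rule valid_between)
  show "valid j z (stage z j) (stage z (max j u))" by (rule stage_valid[OF z]) simp
  have "u \<le> length (stage z (max j u))" using stage_length[OF z, of "max j u"] by simp
  from restr_bound[OF z this] show "prefix (restr (bound z) u) (stage z (max j u))" by (simp only: take_is_prefix)
  have "stage z j = restr (bound z) (length (stage z j))" using restr_bound[OF z order_refl, of j] by simp
  also have "prefix \<dots> (restr (bound z) u)"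
    using u by (metis map_mono_prefix le_add_diff_inverse upt_add_eq_append le0 prefixI)
  finally show "prefix (stage z j) (restr (bound z) u)" .
qed

text \<open>Column \<open>i\<close> is frozen from stage \<open>Suc i\<close> on, so it differs from
  \<open>z i\<close> in at most finitely many places.\<close>

lemma below_bound:
  assumes z: "\<forall>i. z i \<in> range g"
  shows "turing_le (z i) (bound z)"
proof (rule turing_le_column)
  fix m assume m: "length (stage z (Suc i)) \<le> m"
  let ?p = "prod_encode (i, m)"
  have mp: "m \<le> ?p" by (rule le_prod_encode_2)
  have "valid (Suc i) z (stage z (Suc i)) (restr (bound z) (Suc ?p))"
    by (rule bound_valid[OF z]) (use m mp in simp)
  then have "restr (bound z) (Suc ?p) ! ?p = z i m"
    unfolding valid_def using m mp by simp
  then show "z i m = bound z ?p" by (simp add: nth_append)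
qed

text \<open>Stage \<open>Suc j\<close>, with \<open>j\<close> the code of the reduction, decides it.
  Since \<open>w\<close> supplies outputs of every length from valid extensions, no length is
  unattainable; since \<open>w\<close> is in the range of \<open>g\<close>, no output leaves the
  tree. The remaining case makes every segment of \<open>w\<close> a segment of some
  \<open>z i\<close> with \<open>i < j\<close>.\<close>

lemma bound_exact:
  assumes z: "\<forall>i. z i \<in> range g" and w: "w \<in> range g" "turing_le w (bound z)"
  shows "\<exists>i. w = z i"
proof -
  obtain e where "\<And>m. eval (bound z) e [m] (if w m then 1 else 0)"
    using w(2) unfolding turing_le_def by blast
  note out = outputs_of_reduction[of "bound z", OF this]
  define j where "j = to_nat e"
  let ?\<rho> = "stage z (Suc j)"
  have computed: "\<exists>\<rho>'. valid j z ?\<rho> \<rho>' \<and> outputs e \<rho>' (restr w n)" for n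
  proof -
    obtain u where u: "outputs e (restr (bound z) u) (restr w n)" using out by blast
    define v where "v = max u (length ?\<rho>)"
    have "prefix (restr (bound z) u) (restr (bound z) v)"
      by (metis map_mono_prefix le_add_diff_inverse upt_add_eq_append le0 prefixI max.cobounded1 v_def)
    then have "outputs e (restr (bound z) v) (restr w n)" by (rule outputs_prefix[OF u])
    moreover have "valid j z ?\<rho> (restr (bound z) v)"
      by (rule valid_mono[OF bound_valid[OF z]]) (simp_all add: v_def)
    ultimately show ?thesis by blast
  qed
  have "decided e j z ?\<rho>" using stage_step[OF z, of j] unfolding step_def j_def by simp
  then consider
     (a) "\<And>\<rho>' \<tau>. valid j z ?\<rho> \<rho>' \<Longrightarrow> outputs e \<rho>' \<tau> \<Longrightarrow> \<exists>i\<in>{..<j}. \<forall>m\<in>{..<length \<tau>}. \<tau> ! m = z i m"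
   | (b) n where "\<And>\<rho>' \<tau>. valid j z ?\<rho> \<rho>' \<Longrightarrow> length \<tau> = n \<Longrightarrow> \<not> outputs e \<rho>' \<tau>"
   | (c) \<tau> where "outputs e ?\<rho> \<tau>" "\<And>x. \<tau> \<noteq> restr (g x) (length \<tau>)"
    unfolding decided_def by blast
  then show ?thesis
  proof cases
    case a
    show ?thesis
    proof (rule ccontr)
      assume "\<not> ?thesis"
      then have "\<forall>i. \<exists>d. w d \<noteq> z i d" by (auto simp: fun_eq_iff)
      then obtain d where d: "\<And>i. w (d i) \<noteq> z i (d i)" by metis
      \<comment> \<open>This exceeds a place of disagreement between \<open>w\<close> and each of
        the finitely many \<open>z i\<close> with \<open>i < j\<close>.\<close>
      define n where "n = Suc (Max (insert 0 (d ` {..<j})))"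
      have dn: "d i < n" if "i < j" for i
        unfolding n_def less_Suc_eq_le by (rule Max_ge) (use that in auto)
      obtain \<rho>' where "valid j z ?\<rho> \<rho>'" "outputs e \<rho>' (restr w n)" using computed by blast
      from a[OF this] obtain i where "i < j" "\<forall>m<n. w m = z i m" by auto
      then show False using d dn by blast
    qed
  next
    case b
    then show ?thesis using computed[of n] by (metis length_map length_upt diff_zero)
  next
    case c
    obtain \<rho>' where r: "valid j z ?\<rho> \<rho>'" "outputs e \<rho>' (restr w (length \<tau>))" using computed by blast
    have "\<tau> = restr w (length \<tau>)"
      by (rule outputs_unique[OF outputs_prefix[OF c(1) valid_prefix[OF r(1)]] r(2)]) simp
    then show ?thesis using w(1) c(2) by blast
  qed
qed

section \<open>Borel dependence of the bound on the sequence\<close>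

lemma pred_valid [measurable]:
  assumes [measurable]: "\<And>i. (\<lambda>x. Z x i) \<in> M \<rightarrow>\<^sub>M cantor_algebra"
  shows "Measurable.pred M (\<lambda>x. valid k (Z x) \<rho> \<rho>')"
  unfolding valid_def by measurable

lemma pred_decided [measurable]:
  assumes [measurable]: "\<And>i. (\<lambda>x. Z x i) \<in> M \<rightarrow>\<^sub>M cantor_algebra"
  shows "Measurable.pred M (\<lambda>x. decided e k (Z x) \<rho>)"
  unfolding decided_def by measurable

lemma stage_measurable:
  assumes Z [measurable]: "\<And>i. (\<lambda>x. Z x i) \<in> M \<rightarrow>\<^sub>M cantor_algebra"
  shows "(\<lambda>x. stage (Z x) j) \<in> M \<rightarrow>\<^sub>M count_space UNIV"
proof (induction j)
  case (Suc j)
  have "Measurable.pred M (\<lambda>x. step j (Z x) (stage (Z x) j) (from_nat c))" for c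
    \<comment> \<open>The stage takes countably many values, so it may be replaced by a fixed
      string.\<close>
    by (rule measurable_compose_countable[OF _ Suc]) (unfold step_def, measurable)
  then have "(\<lambda>x. LEAST c. step j (Z x) (stage (Z x) j) (from_nat c)) \<in> M \<rightarrow>\<^sub>M count_space UNIV"
    by (rule measurable_Least)
  then show ?case unfolding stage.simps by (rule measurable_compose) simp
qed simp

lemma bound_measurable:
  assumes Z: "\<And>i. (\<lambda>x. Z x i) \<in> M \<rightarrow>\<^sub>M cantor_algebra"
  shows "(\<lambda>x. bound (Z x)) \<in> M \<rightarrow>\<^sub>M cantor_algebra"
proof (rule measurable_into_cantor)
  fix p
  show "Measurable.pred M (\<lambda>x. bound (Z x) p)"
    unfolding bound_def by (rule measurable_compose[OF stage_measurable[OF Z]]) simp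
qed

end

section \<open>Embedding orders of height two\<close>

theorem theorem1p6:
  fixes P :: "cantor set" and R :: "(cantor \<times> cantor) set"
  assumes "P \<in> cantor_borel"
    and "R \<in> cantor2_borel"
    and "R \<subseteq> P \<times> P"
    and "partial_order_on P R"
    and "locally_countable P R"
    and "has_height P R 2"
  shows "\<exists>f. borel_measurable_on P f \<and>
             (\<forall>x\<in>P. \<forall>y\<in>P. (x, y) \<in> R \<longleftrightarrow> turing_le (f x) (f y))"
proof -
  have refl: "\<And>x. x \<in> P \<Longrightarrow> (x, x) \<in> R" and antisym: "\<And>x y. (x, y) \<in> R \<Longrightarrow> (y, x) \<in> R \<Longrightarrow> x = y"
    and trans: "\<And>x y z. (x, y) \<in> R \<Longrightarrow> (y, z) \<in> R \<Longrightarrow> (x, z) \<in> R"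
    using assms(4) unfolding partial_order_on_def preorder_on_def
    by (auto dest: refl_onD antisymD transD)
  have R: "R \<in> sets cantor2_algebra" using assms(2) by (simp add: sets_cantor2_algebra)
  have "countable {x. (x, y) \<in> R}" for y
  proof (cases "y \<in> P")
    case True
    have "{x. (x, y) \<in> R} \<subseteq> insert y {x\<in>P. (x, y) \<in> R \<and> x \<noteq> y}" using assms(3) by auto
    moreover have "countable (insert y {x\<in>P. (x, y) \<in> R \<and> x \<noteq> y})"
      using assms(5) True unfolding locally_countable_def by simp
    ultimately show ?thesis by (rule countable_subset)
  next
    case False
    then have "{x. (x, y) \<in> R} = {}" using assms(3) by auto
    then show ?thesis by simp
  qed
  from lusin_novikov_cover[OF R this] obtain h :: "nat \<Rightarrow> cantor \<Rightarrow> cantor"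
    where h [measurable]: "\<And>n. h n \<in> cantor_algebra \<rightarrow>\<^sub>M cantor_algebra"
      and cover: "\<And>x y. (x, y) \<in> R \<Longrightarrow> \<exists>n. x = h n y" by blast
  \<comment> \<open>The default \<open>y\<close> keeps every value weakly below \<open>y\<close>
    when \<open>y \<in> P\<close>.\<close>
  define pre where "pre n y = (if (h n y, y) \<in> R then h n y else y)" for n y
  have pre_le: "(pre n y, y) \<in> R" if "y \<in> P" for n y using refl[OF that] by (simp add: pre_def)
  have pre_cover: "\<exists>n. x = pre n y" if "(x, y) \<in> R" for x y
    using cover[OF that] that unfolding pre_def by metis
  have [measurable]: "Measurable.pred cantor_algebra (\<lambda>y. (h n y, y) \<in> R)" for n
  proof -
    have "(\<lambda>y. (h n y, y)) \<in> cantor_algebra \<rightarrow>\<^sub>M cantor2_algebra"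
      by (rule measurable_into_cantor2) measurable
    then show ?thesis using R by measurable
  qed
  have pre_meas [measurable]: "pre n \<in> cantor_algebra \<rightarrow>\<^sub>M cantor_algebra" for n
    unfolding pre_def by measurable

  obtain g where "g \<in> cantor_algebra \<rightarrow>\<^sub>M cantor_algebra" "inj g" "avoiding g"
    using exists_avoiding_map by blast
  then interpret avoiding_map g by unfold_locales
  \<comment> \<open>For \<open>y \<in> P\<close> this says that \<open>y\<close> has no strict
    predecessor; the quantifier over \<open>n\<close> keeps the condition Borel.\<close>
  define minimal where "minimal y \<longleftrightarrow> (\<forall>n. pre n y = y)" for y
  define f where "f y = (if minimal y then g y else bound (\<lambda>n. g (pre n y)))" for y
  have "Measurable.pred cantor_algebra (\<lambda>y. \<forall>n k. pre n y k = y k)" by measurable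
  then have [measurable]: "Measurable.pred cantor_algebra minimal"
    unfolding minimal_def fun_eq_iff by simp
  have [measurable]: "(\<lambda>y. bound (\<lambda>n. g (pre n y))) \<in> cantor_algebra \<rightarrow>\<^sub>M cantor_algebra"
    by (rule bound_measurable) (rule measurable_compose[OF pre_meas g_measurable])
  note g_measurable [measurable]
  have f_meas: "f \<in> cantor_algebra \<rightarrow>\<^sub>M cantor_algebra" unfolding f_def by measurable
  have "borel_measurable_on P f"
    unfolding borel_measurable_on_def
  proof
    fix B assume "B \<in> cantor_borel"
    then have "f -` B \<inter> space cantor_algebra \<in> sets cantor_algebra"
      by (intro measurable_sets[OF f_meas]) (simp add: sets_cantor_algebra)
    then have "P \<inter> f -` B \<in> sets cantor_algebra"
      using assms(1) by (intro sets.Int) (simp_all add: sets_cantor_algebra)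
    then show "P \<inter> f -` B \<in> cantor_borel" by (simp add: sets_cantor_algebra)
  qed
  moreover have "(x, y) \<in> R \<longleftrightarrow> turing_le (f x) (f y)" if P: "x \<in> P" "y \<in> P" for x y
  proof
    assume xy: "(x, y) \<in> R"
    show "turing_le (f x) (f y)"
    proof (cases "x = y")
      case True
      then show ?thesis by (simp add: turing_le_refl)
    next
      case False
      \<comment> \<open>A strict predecessor of \<open>x\<close> would form a three-element chain
        with \<open>x\<close> and \<open>y\<close>, exceeding the height.\<close>
      have "minimal x"
        unfolding minimal_def
      proof (rule allI, rule ccontr)
        fix n assume ne: "pre n x \<noteq> x"
        have px: "(pre n x, x) \<in> R" using pre_le P(1) by blast
        then have py: "(pre n x, y) \<in> R" using trans xy by blast
        have "pre n x \<noteq> y" using antisym xy px False by metis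
        then have card: "card {pre n x, x, y} = 3" using ne False by simp
        have "is_chain P R {pre n x, x, y}"
          unfolding is_chain_def using px py xy P refl assms(3) by auto
        then show False using assms(6) card unfolding has_height_def by fastforce
      qed
      moreover obtain n where n: "x = pre n y" using pre_cover[OF xy] by blast
      then have "\<not> minimal y" using False unfolding minimal_def by metis
      moreover have "turing_le (g (pre n y)) (bound (\<lambda>n. g (pre n y)))"
        using below_bound[of "\<lambda>n. g (pre n y)" n] by simp
      ultimately show ?thesis using n by (simp add: f_def)
    qed
  next
    assume le: "turing_le (f x) (f y)"
    \<comment> \<open>By reflexivity \<open>x\<close> occurs among its own \<open>pre n x\<close>,
      so \<open>g x\<close> tests membership of \<open>x\<close> below \<open>y\<close> even when
      \<open>x\<close> is not minimal.\<close>
    have "turing_le (g x) (f x)"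
    proof (cases "minimal x")
      case True
      then show ?thesis by (simp add: f_def turing_le_refl)
    next
      case False
      obtain n where "x = pre n x" using pre_cover refl P(1) by blast
      then show ?thesis using below_bound[of "\<lambda>n. g (pre n x)" n] False by (simp add: f_def)
    qed
    then have gy: "turing_le (g x) (f y)" using le by (rule turing_le_trans)
    show "(x, y) \<in> R"
    proof (cases "minimal y")
      case True
      \<comment> \<open>Exactness for the constant sequence shows that distinct elements of the
        range of \<open>g\<close> are Turing incomparable.\<close>
      have "turing_le (g y) (bound (\<lambda>_. g y))" using below_bound[of "\<lambda>_. g y"] by simp
      then have "turing_le (g x) (bound (\<lambda>_. g y))" using gy True turing_le_trans by (simp add: f_def)
      then have "g x = g y" using bound_exact[of "\<lambda>_. g y" "g x"] by simp
      then show ?thesis using g_inj refl P by (simp add: inj_eq)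
    next
      case False
      then have "turing_le (g x) (bound (\<lambda>n. g (pre n y)))" using gy by (simp add: f_def)
      then obtain n where "g x = g (pre n y)" using bound_exact[of "\<lambda>n. g (pre n y)" "g x"] by auto
      then show ?thesis using g_inj pre_le P(2) by (simp add: inj_eq)
    qed
  qed
  ultimately show ?thesis by blast
qed

end
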